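(* Consider the linear system $$(A_t\otimes M_x+M_t\otimes A_x)\,u=F,\qquad A_t,M_t\in\mathbb{R}^{N_t\times N_t},\quad M_x,A_x\in\mathbb{R}^{m\times m},\quad F\in\mathbb{R}^{N_t m},$$ described in the context, and the following algorithm (Bartels-Stewart method with complex-Schur decomposition). Step 1: Compute a complex-Schur decomposition $A_t^{-1}M_t=WSW^*$ with $W\in\mathbb{C}^{N_t\times N_t}$ unitary and $S\in\mathbb{C}^{N_t\times N_t}$ upper triangular. Step 2: Compute $g=(g_1,\dots,g_{N_t})=\mathrm{vec}(\hat FA_t^{-1}\overline{W})$ with $g_k\in\mathbb{C}^m$, where $\hat F\in\mathbb{R}^{m\times N_t}$ satisfies $\mathrm{vec}(\hat F)=F$. Step 3: For $k=N_t,N_t-1,\dots,1$ solve $$(M_x+S[k,k]A_x)z_k=g_k-\sum_{j=k+1}^{N_t}S[k,j]A_xz_j$$ for $z_k\in\mathbb{C}^m$. Step 4: Output $u=\mathrm{vec}(ZW^\top)$, where $Z=(z_1\,|\,\cdots\,|\,z_{N_t})\in\mathbb{C}^{m\times N_t}$. Then every linear system in Step 3 is uniquely solvable, and the output $u$ is the solution of the given linear system. Moreover, if solving one spatial linear system of Step 3 requires $\mathcal{O}(C_C(m))$ operations and $\mathcal{O}(C_S(m))$ storage, then the overall computational cost and the overall memory consumption of the algorithm are, respectively, $$\mathcal{O}\bigl(N_t^3+m N_t^2+C_C(m)\,N_t\bigr)\qquad\text{and}\qquad\mathcal{O}\bigl(N_t^2+m N_t+C_S(m)\bigr).$$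
   Context: Discrete problem. Let $T>0$ and let $\Omega\subset\mathbb{R}^d$, $d\in\{1,2,3\}$, be a bounded Lipschitz domain (an interval $(0,L)$ if $d=1$, polygonal if $d=2$, polyhedral if $d=3$); $Q_T:=\Omega\times(0,T)$. Let $0=t_0<t_1<\dots<t_{N_t}=T$, and let $\varphi_0,\dots,\varphi_{N_t}$ be the usual nodal hat functions (continuous, piecewise linear) on this time mesh. Let $\{\omega_1,\dots,\omega_{N_x}\}$ be a member of a shape-regular sequence of admissible decompositions of $\Omega$ into intervals ($d=1$), triangles or quadrilaterals ($d=2$), tetrahedra or hexahedra ($d=3$), and let $\psi_1,\dots,\psi_m$ be the nodal basis of the space of continuous piecewise linear (respectively linear/bilinear/trilinear) finite element functions vanishing on $\partial\Omega$. The modified Hilbert transformation $\mathcal{H}_T$ on $L^2(0,T)$ is defined by: if $v(t)=\sum_{k\ge0}v_k\sin\bigl((\tfrac{\pi}{2}+k\pi)\tfrac{t}{T}\bigr)$, then $(\mathcal{H}_Tv)(t)=\sum_{k\ge0}v_k\cos\bigl((\tfrac{\pi}{2}+k\pi)\tfrac{t}{T}\bigr)$. The matrices are $$M_x[i,j]=\langle\psi_j,\psi_i\rangle_{L^2(\Omega)},\quad A_x[i,j]=\langle\nabla\psi_j,\nabla\psi_i\rangle_{L^2(\Omega)}\quad(i,j=1,\dots,m),$$ $$M_t[\ell,k]=\langle\varphi_k,\mathcal{H}_T\varphi_\ell\rangle_{L^2(0,T)},\quad A_t[\ell,k]=\langle\partial_t\varphi_k,\mathcal{H}_T\varphi_\ell\rangle_{L^2(0,T)}\quad(\ell,k=1,\dots,N_t).$$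 Known facts: $M_x,A_x,A_t$ are symmetric positive definite; $M_t$ is nonsymmetric and positive definite, i.e. $x^\top M_tx>0$ for all real $x\neq0$; $M_x,A_x$ are sparse ($\mathcal{O}(m)$ nonzero entries). The right-hand side is $F=\mathrm{vec}(\widetilde F)\in\mathbb{R}^{N_tm}$ with $\widetilde F[i,k]=\langle Q_h^0f,\psi_i\,\mathcal{H}_T\varphi_k\rangle_{L^2(Q_T)}$, $i=1,\dots,m$, $k=1,\dots,N_t$, where $f\in L^2(Q_T)$ and $Q_h^0$ is the $L^2(Q_T)$-orthogonal projection onto functions that are constant on every space-time element $\omega_i\times(t_{\ell-1},t_\ell)$. Conventions. $\otimes$ is the Kronecker product of matrices; $\mathrm{vec}$ stacks the columns of a matrix into one vector; $\overline{W}$ is the entrywise complex conjugate, $W^\top$ the transpose and $W^*$ the conjugate transpose. Empty sums are $0$. Computational cost counts arithmetic operations and memory counts stored numbers; the factorization in Step 1 is counted at its standard dense cost of $\mathcal{O}(N_t^3)$ operations and $\mathcal{O}(N_t^2)$ storage, and $A_t$ is applied inversely through a Cholesky factorization. $C_C$ and $C_S$ denote the cost and storage functions of the chosen spatial solver. *)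

theory Defs
  imports
    "HOL-Analysis.Analysis"
    "HOL-Library.State_Monad"
    "Jordan_Normal_Form.Determinant"
    "Jordan_Normal_Form.Gauss_Jordan_Elimination"
    "Jordan_Normal_Form.Schur_Decomposition"
begin

unbundle no vec_syntax

section \<open>Spatial domain and finite element meshes\<close>

text \<open>Near every boundary point the domain is the strict epigraph of a Lipschitz function of the
  coordinates orthogonal to some unit vector \<open>e\<close>.\<close>

definition lipschitz_boundary :: "'a::euclidean_space set \<Rightarrow> bool" where
  "lipschitz_boundary \<Omega> \<longleftrightarrow> (\<forall>p\<in>frontier \<Omega>. \<exists>r>0. \<exists>e \<gamma> L. norm e = 1 \<and> L-lipschitz_on UNIV \<gamma> \<and>
     (\<forall>x\<in>ball p r. x \<in> \<Omega> \<longleftrightarrow> \<gamma> (x - inner x e *\<^sub>R e) < inner x e))"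

definition spatial_domain :: "'a::euclidean_space set \<Rightarrow> bool" where
  "spatial_domain \<Omega> \<longleftrightarrow> open \<Omega> \<and> connected \<Omega> \<and> bounded \<Omega> \<and> \<Omega> \<noteq> {} \<and> lipschitz_boundary \<Omega> \<and>
     (if DIM('a) = 1 then \<exists>L>0. \<Omega> = box 0 (L *\<^sub>R One)
      else \<exists>P. finite P \<and> (\<forall>p\<in>P. polytope p) \<and> closure \<Omega> = \<Union>P)"

text \<open>Intervals, triangles and tetrahedra are affine images of the unit simplex; intervals,
  quadrilaterals and hexahedra are multilinear images of the unit cube.  An element is given by its
  shape and its reference map.\<close>

datatype shape = Simplex | Cube

type_synonym 'a element = "shape \<times> ('a \<Rightarrow> 'a)"

primrec reference_cell :: "shape \<Rightarrow> 'a::euclidean_space set" where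
  "reference_cell Simplex = convex hull (insert 0 Basis)"
| "reference_cell Cube = cbox 0 One"

primrec monomials :: "shape \<Rightarrow> 'a::euclidean_space set set" where
  "monomials Simplex = {I. I \<subseteq> Basis \<and> card I \<le> 1}"
| "monomials Cube = Pow Basis"

text \<open>Affine functions for the simplex, (bi/tri)linear functions for the cube.\<close>

definition shape_functions :: "shape \<Rightarrow> ('a::euclidean_space \<Rightarrow> real) set" where
  "shape_functions s = {p. \<exists>c. p = (\<lambda>\<xi>. \<Sum>I\<in>monomials s. c I * (\<Prod>b\<in>I. inner \<xi> b))}"

definition valid_element :: "'a::euclidean_space element \<Rightarrow> bool" where
  "valid_element e \<longleftrightarrow> (\<forall>b\<in>Basis. (\<lambda>\<xi>. inner (snd e \<xi>) b) \<in> shape_functions (fst e)) \<and>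
     inj_on (snd e) (reference_cell (fst e)) \<and>
     (\<forall>\<xi>\<in>reference_cell (fst e). \<exists>D. (snd e has_derivative D) (at \<xi>) \<and> inj D)"

definition closed_cell :: "'a::euclidean_space element \<Rightarrow> 'a set" where
  "closed_cell e = snd e ` reference_cell (fst e)"

definition open_cell :: "'a::euclidean_space element \<Rightarrow> 'a set" where
  "open_cell e = snd e ` interior (reference_cell (fst e))"

definition vertices :: "'a::euclidean_space element \<Rightarrow> 'a set" where
  "vertices e = snd e ` {v. v extreme_point_of reference_cell (fst e)}"

text \<open>No hanging nodes: two closed elements meet in a common face (possibly empty, a vertex, an
  edge, \<open>\<dots>\<close>) of both of them.\<close>

definition admissible_decomposition :: "'a::euclidean_space set \<Rightarrow> 'a element set \<Rightarrow> bool" where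
  "admissible_decomposition \<Omega> E \<longleftrightarrow> finite E \<and> (\<forall>e\<in>E. valid_element e) \<and>
     closure \<Omega> = (\<Union>e\<in>E. closed_cell e) \<and>
     (\<forall>e\<in>E. \<forall>e'\<in>E. e \<noteq> e' \<longrightarrow> open_cell e \<inter> open_cell e' = {} \<and>
        (\<exists>K K'. K face_of reference_cell (fst e) \<and> K' face_of reference_cell (fst e') \<and>
           closed_cell e \<inter> closed_cell e' = snd e ` K \<and>
           closed_cell e \<inter> closed_cell e' = snd e' ` K'))"

definition shape_regular_sequence :: "'a::euclidean_space set \<Rightarrow> (nat \<Rightarrow> 'a element set) \<Rightarrow> bool" where
  "shape_regular_sequence \<Omega> E \<longleftrightarrow> (\<forall>n. admissible_decomposition \<Omega> (E n)) \<and>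
     (\<exists>c>0. \<forall>n. \<forall>e\<in>E n. \<exists>x r. 0 < r \<and> ball x r \<subseteq> closed_cell e \<and> diameter (closed_cell e) \<le> c * r)"

definition fe_space :: "'a::euclidean_space set \<Rightarrow> 'a element set \<Rightarrow> ('a \<Rightarrow> real) set" where
  "fe_space \<Omega> E = {v. continuous_on (closure \<Omega>) v \<and> (\<forall>x\<in>frontier \<Omega>. v x = 0) \<and>
     (\<forall>e\<in>E. \<exists>p\<in>shape_functions (fst e). \<forall>\<xi>\<in>reference_cell (fst e). v (snd e \<xi>) = p \<xi>)}"

definition nodal_basis ::
  "'a::euclidean_space set \<Rightarrow> 'a element set \<Rightarrow> nat \<Rightarrow> (nat \<Rightarrow> 'a \<Rightarrow> real) \<Rightarrow> bool" where
  "nodal_basis \<Omega> E m \<psi> \<longleftrightarrow> (\<exists>x. bij_betw x {..<m} ((\<Union>e\<in>E. vertices e) \<inter> \<Omega>) \<and>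
     (\<forall>i<m. \<psi> i \<in> fe_space \<Omega> E \<and> (\<forall>j<m. \<psi> i (x j) = (if i = j then 1 else 0))))"

definition grad :: "('a::euclidean_space \<Rightarrow> real) \<Rightarrow> 'a \<Rightarrow> 'a" where
  "grad v x = (SOME D. GDERIV v x :> D)"

definition mass_x :: "'a::euclidean_space set \<Rightarrow> nat \<Rightarrow> (nat \<Rightarrow> 'a \<Rightarrow> real) \<Rightarrow> real mat" where
  "mass_x \<Omega> m \<psi> = mat m m (\<lambda>(i,j). LINT x:\<Omega>|lebesgue. \<psi> j x * \<psi> i x)"

text \<open>\<open>grad\<close> is unspecified on the element boundaries where a finite element function has a kink;
  these form a null set.\<close>

definition stiffness_x :: "'a::euclidean_space set \<Rightarrow> nat \<Rightarrow> (nat \<Rightarrow> 'a \<Rightarrow> real) \<Rightarrow> real mat" where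
  "stiffness_x \<Omega> m \<psi> = mat m m (\<lambda>(i,j). LINT x:\<Omega>|lebesgue. inner (grad (\<psi> j) x) (grad (\<psi> i) x))"


section \<open>Temporal discretization\<close>

definition time_mesh :: "real \<Rightarrow> nat \<Rightarrow> (nat \<Rightarrow> real) \<Rightarrow> bool" where
  "time_mesh T N t \<longleftrightarrow> t 0 = 0 \<and> t N = T \<and> (\<forall>l<N. t l < t (Suc l))"

definition hat :: "nat \<Rightarrow> (nat \<Rightarrow> real) \<Rightarrow> nat \<Rightarrow> real \<Rightarrow> real" where
  "hat N t k s =
     (if 0 < k \<and> t (k - 1) \<le> s \<and> s \<le> t k then (s - t (k - 1)) / (t k - t (k - 1))
      else if k < N \<and> t k \<le> s \<and> s \<le> t (k + 1) then (t (k + 1) - s) / (t (k + 1) - t k)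
      else 0)"

definition square_integrable :: "'a::euclidean_space set \<Rightarrow> ('a \<Rightarrow> real) \<Rightarrow> bool" where
  "square_integrable S v \<longleftrightarrow>
     set_borel_measurable lebesgue S v \<and> set_integrable lebesgue S (\<lambda>x. (v x)\<^sup>2)"

definition l2_tendsto :: "'a::euclidean_space set \<Rightarrow> (nat \<Rightarrow> 'a \<Rightarrow> real) \<Rightarrow> ('a \<Rightarrow> real) \<Rightarrow> bool" where
  "l2_tendsto S s v \<longleftrightarrow> square_integrable S v \<and> (\<forall>n. square_integrable S (s n)) \<and>
     (\<lambda>n. LINT x:S|lebesgue. (s n x - v x)\<^sup>2) \<longlonglongrightarrow> 0"

definition hilbert_freq :: "real \<Rightarrow> nat \<Rightarrow> real" where
  "hilbert_freq T k = (pi / 2 + real k * pi) / T"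

text \<open>The series are \<open>L\<^sup>2(0,T)\<close>-convergent, so \<open>modified_hilbert T v\<close> is a representative of a
  class modulo null sets.\<close>

definition is_modified_hilbert :: "real \<Rightarrow> (real \<Rightarrow> real) \<Rightarrow> (real \<Rightarrow> real) \<Rightarrow> bool" where
  "is_modified_hilbert T v h \<longleftrightarrow> (\<exists>c :: nat \<Rightarrow> real.
     l2_tendsto {0<..<T} (\<lambda>n s. \<Sum>k<n. c k * sin (hilbert_freq T k * s)) v \<and>
     l2_tendsto {0<..<T} (\<lambda>n s. \<Sum>k<n. c k * cos (hilbert_freq T k * s)) h)"

definition modified_hilbert :: "real \<Rightarrow> (real \<Rightarrow> real) \<Rightarrow> real \<Rightarrow> real" where
  "modified_hilbert T v = (SOME h. is_modified_hilbert T v h)"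

text \<open>Matrix indices start at \<open>0\<close>: row and column \<open>k\<close> of the temporal matrices belong to the hat
  function with number \<open>k + 1\<close>.\<close>

definition mass_t :: "real \<Rightarrow> nat \<Rightarrow> (nat \<Rightarrow> real) \<Rightarrow> real mat" where
  "mass_t T N t = mat N N (\<lambda>(l,k). LINT s:{0<..<T}|lebesgue.
     hat N t (Suc k) s * modified_hilbert T (hat N t (Suc l)) s)"

definition stiffness_t :: "real \<Rightarrow> nat \<Rightarrow> (nat \<Rightarrow> real) \<Rightarrow> real mat" where
  "stiffness_t T N t = mat N N (\<lambda>(l,k). LINT s:{0<..<T}|lebesgue.
     deriv (hat N t (Suc k)) s * modified_hilbert T (hat N t (Suc l)) s)"


section \<open>Right-hand side\<close>

definition piecewise_constant ::
  "'a::euclidean_space element set \<Rightarrow> nat \<Rightarrow> (nat \<Rightarrow> real) \<Rightarrow> ('a \<times> real \<Rightarrow> real) set" where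
  "piecewise_constant E N t = {q. \<forall>e\<in>E. \<forall>l<N. \<exists>c. \<forall>z \<in> open_cell e \<times> {t l<..<t (Suc l)}. q z = c}"

definition l2_projection ::
  "'a::euclidean_space set \<Rightarrow> real \<Rightarrow> 'a element set \<Rightarrow> nat \<Rightarrow> (nat \<Rightarrow> real) \<Rightarrow>
   ('a \<times> real \<Rightarrow> real) \<Rightarrow> 'a \<times> real \<Rightarrow> real" where
  "l2_projection \<Omega> T E N t f = (SOME p. p \<in> piecewise_constant E N t \<and>
     (\<forall>q\<in>piecewise_constant E N t. (LINT z:\<Omega> \<times> {0<..<T}|lebesgue. (f z - p z) * q z) = 0))"

definition load_matrix ::
  "'a::euclidean_space set \<Rightarrow> real \<Rightarrow> 'a element set \<Rightarrow> nat \<Rightarrow> (nat \<Rightarrow> 'a \<Rightarrow> real) \<Rightarrow>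
   nat \<Rightarrow> (nat \<Rightarrow> real) \<Rightarrow> ('a \<times> real \<Rightarrow> real) \<Rightarrow> real mat" where
  "load_matrix \<Omega> T E m \<psi> N t f = mat m N (\<lambda>(i,k). LINT z:\<Omega> \<times> {0<..<T}|lebesgue.
     l2_projection \<Omega> T E N t f z * (\<psi> i (fst z) * modified_hilbert T (hat N t (Suc k)) (snd z)))"


section \<open>Linear algebra\<close>

definition kronecker :: "'b::times mat \<Rightarrow> 'b mat \<Rightarrow> 'b mat" (infixl \<open>\<otimes>\<^sub>K\<close> 70) where
  "A \<otimes>\<^sub>K B = mat (dim_row A * dim_row B) (dim_col A * dim_col B)
     (\<lambda>(p,q). A $$ (p div dim_row B, q div dim_col B) * B $$ (p mod dim_row B, q mod dim_col B))"

definition stack_cols :: "'b mat \<Rightarrow> 'b vec" where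
  "stack_cols A = vec (dim_col A * dim_row A) (\<lambda>p. A $$ (p mod dim_row A, p div dim_row A))"

definition positive_definite :: "nat \<Rightarrow> real mat \<Rightarrow> bool" where
  "positive_definite n A \<longleftrightarrow> A \<in> carrier_mat n n \<and>
     (\<forall>x\<in>carrier_vec n. x \<noteq> 0\<^sub>v n \<longrightarrow> 0 < scalar_prod x (A *\<^sub>v x))"

definition spd :: "nat \<Rightarrow> real mat \<Rightarrow> bool" where
  "spd n A \<longleftrightarrow> positive_definite n A \<and> transpose_mat A = A"

definition nnz :: "'b::zero mat \<Rightarrow> nat" where
  "nnz A = card {(i,j). i < dim_row A \<and> j < dim_col A \<and> A $$ (i,j) \<noteq> 0}"

abbreviation mat_inv :: "'b::field mat \<Rightarrow> 'b mat" where
  "mat_inv A \<equiv> the (mat_inverse A)"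

abbreviation cmat :: "real mat \<Rightarrow> complex mat" where
  "cmat \<equiv> map_mat complex_of_real"

definition unitary :: "nat \<Rightarrow> complex mat \<Rightarrow> bool" where
  "unitary n W \<longleftrightarrow> W \<in> carrier_mat n n \<and> W * mat_adjoint W = 1\<^sub>m n \<and> mat_adjoint W * W = 1\<^sub>m n"

definition complex_schur :: "nat \<Rightarrow> complex mat \<Rightarrow> complex mat \<Rightarrow> complex mat \<Rightarrow> bool" where
  "complex_schur n B W S \<longleftrightarrow> unitary n W \<and> S \<in> carrier_mat n n \<and> upper_triangular S \<and>
     B = W * S * mat_adjoint W"

definition unique_solution :: "real mat \<Rightarrow> real vec \<Rightarrow> real vec \<Rightarrow> bool" where
  "unique_solution K F x \<longleftrightarrow> x \<in> carrier_vec (dim_col K) \<and> K *\<^sub>v x = F \<and>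
     (\<forall>y\<in>carrier_vec (dim_col K). K *\<^sub>v y = F \<longrightarrow> y = x)"


section \<open>The Bartels-Stewart method\<close>

definition step3_matrix :: "real mat \<Rightarrow> real mat \<Rightarrow> complex mat \<Rightarrow> nat \<Rightarrow> complex mat" where
  "step3_matrix M\<^sub>x A\<^sub>x S k = cmat M\<^sub>x + S $$ (k,k) \<cdot>\<^sub>m cmat A\<^sub>x"

definition step3_rhs ::
  "real mat \<Rightarrow> complex mat \<Rightarrow> complex mat \<Rightarrow> complex mat \<Rightarrow> nat \<Rightarrow> complex vec" where
  "step3_rhs A\<^sub>x S G Z k = vec (dim_row A\<^sub>x) (\<lambda>i. G $$ (i,k) -
     (\<Sum>j\<in>{k<..<dim_col S}. S $$ (k,j) * (cmat A\<^sub>x *\<^sub>v col Z j) $ i))"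

text \<open>\<open>u\<close> is an output of the algorithm on the input \<open>F' \<in> \<real>\<^bsup>m \<times> N\<^esup>\<close> (the unstacked right-hand
  side), for some admissible choices in Steps 1 and 3.\<close>

definition bartels_stewart_output ::
  "nat \<Rightarrow> nat \<Rightarrow> real mat \<Rightarrow> real mat \<Rightarrow> real mat \<Rightarrow> real mat \<Rightarrow> real mat \<Rightarrow> complex vec \<Rightarrow> bool" where
  "bartels_stewart_output N m A\<^sub>t M\<^sub>t M\<^sub>x A\<^sub>x F' u \<longleftrightarrow> (\<exists>W S G Z.
     complex_schur N (cmat (mat_inv A\<^sub>t * M\<^sub>t)) W S \<and>
     G = cmat (F' * mat_inv A\<^sub>t) * map_mat cnj W \<and>
     Z \<in> carrier_mat m N \<and>
     (\<forall>k<N. step3_matrix M\<^sub>x A\<^sub>x S k *\<^sub>v col Z k = step3_rhs A\<^sub>x S G Z k) \<and>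
     u = stack_cols (Z * transpose_mat W))"


section \<open>Operation and storage count\<close>

text \<open>Programs are computations in a state monad over the number of arithmetic operations performed
  so far, the number of array entries currently stored and the maximum of the latter.  A complex
  number counts as one number and an operation on complex numbers as one operation.  The bounded
  number of scalar registers used by the loops below is not counted.\<close>

record usage =
  ops :: nat
  live :: nat
  peak :: nat

type_synonym 'b prog = "(usage, 'b) state"

abbreviation ret :: "'b \<Rightarrow> 'b prog" where "ret \<equiv> State_Monad.return"

definition tick :: "nat \<Rightarrow> unit prog" where
  "tick n = State_Monad.update (\<lambda>u. u\<lparr>ops := ops u + n\<rparr>)"

definition alloc :: "nat \<Rightarrow> unit prog" where
  "alloc n = State_Monad.update (\<lambda>u. u\<lparr>live := live u + n, peak := max (peak u) (live u + n)\<rparr>)"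

definition release :: "nat \<Rightarrow> unit prog" where
  "release n = State_Monad.update (\<lambda>u. u\<lparr>live := live u - n\<rparr>)"

definition add_op :: "'b::plus \<Rightarrow> 'b \<Rightarrow> 'b prog" where "add_op x y = do {tick 1; ret (x + y)}"
definition sub_op :: "'b::minus \<Rightarrow> 'b \<Rightarrow> 'b prog" where "sub_op x y = do {tick 1; ret (x - y)}"
definition mul_op :: "'b::times \<Rightarrow> 'b \<Rightarrow> 'b prog" where "mul_op x y = do {tick 1; ret (x * y)}"
definition div_op :: "'b::divide \<Rightarrow> 'b \<Rightarrow> 'b prog" where "div_op x y = do {tick 1; ret (x div y)}"
definition sqrt_op :: "real \<Rightarrow> real prog" where "sqrt_op x = do {tick 1; ret (sqrt x)}"
definition cnj_op :: "complex \<Rightarrow> complex prog" where "cnj_op x = do {tick 1; ret (cnj x)}"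

primrec loop :: "('i \<Rightarrow> 's \<Rightarrow> 's prog) \<Rightarrow> 'i list \<Rightarrow> 's \<Rightarrow> 's prog" where
  "loop f [] s = ret s"
| "loop f (i # is) s = do {s' \<leftarrow> f i s; loop f is s'}"

definition new_vec :: "nat \<Rightarrow> 'b::zero vec prog" where
  "new_vec n = do {alloc n; ret (0\<^sub>v n)}"

definition new_mat :: "nat \<Rightarrow> nat \<Rightarrow> 'b::zero mat prog" where
  "new_mat r c = do {alloc (r * c); ret (0\<^sub>m r c)}"

definition dot :: "nat list \<Rightarrow> (nat \<Rightarrow> 'b) \<Rightarrow> (nat \<Rightarrow> 'b) \<Rightarrow> 'b::semiring_0 prog" where
  "dot is a b = loop (\<lambda>i s. do {p \<leftarrow> mul_op (a i) (b i); add_op s p}) is 0"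

definition mat_mult :: "'b::semiring_0 mat \<Rightarrow> 'b mat \<Rightarrow> 'b mat prog" where
  "mat_mult A B = do {
     C \<leftarrow> new_mat (dim_row A) (dim_col B);
     loop (\<lambda>i C. loop (\<lambda>j C. do {
         s \<leftarrow> dot [0..<dim_col A] (\<lambda>l. A $$ (i,l)) (\<lambda>l. B $$ (l,j));
         ret (update_mat C (i,j) s)
       }) [0..<dim_col B] C) [0..<dim_row A] C
   }"

definition mat_cnj :: "complex mat \<Rightarrow> complex mat prog" where
  "mat_cnj A = do {
     C \<leftarrow> new_mat (dim_row A) (dim_col A);
     loop (\<lambda>i C. loop (\<lambda>j C. do {
         a \<leftarrow> cnj_op (A $$ (i,j));
         ret (update_mat C (i,j) a)
       }) [0..<dim_col A] C) [0..<dim_row A] C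
   }"

definition cholesky :: "real mat \<Rightarrow> real mat prog" where
  "cholesky A = do {
     L \<leftarrow> new_mat (dim_row A) (dim_row A);
     loop (\<lambda>j L. do {
         s \<leftarrow> dot [0..<j] (\<lambda>k. L $$ (j,k)) (\<lambda>k. L $$ (j,k));
         d \<leftarrow> sub_op (A $$ (j,j)) s;
         r \<leftarrow> sqrt_op d;
         loop (\<lambda>i L. do {
             s \<leftarrow> dot [0..<j] (\<lambda>k. L $$ (i,k)) (\<lambda>k. L $$ (j,k));
             a \<leftarrow> sub_op (A $$ (i,j)) s;
             q \<leftarrow> div_op a r;
             ret (update_mat L (i,j) q)
           }) [Suc j..<dim_row A] (update_mat L (j,j) r)
       }) [0..<dim_row A] L
   }"

definition cholesky_solve :: "real mat \<Rightarrow> real vec \<Rightarrow> real vec prog" where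
  "cholesky_solve L b = do {
     y \<leftarrow> new_vec (dim_row L);
     y \<leftarrow> loop (\<lambda>i y. do {
         s \<leftarrow> dot [0..<i] (\<lambda>j. L $$ (i,j)) (\<lambda>j. y $ j);
         a \<leftarrow> sub_op (b $ i) s;
         q \<leftarrow> div_op a (L $$ (i,i));
         ret (update_vec y i q)
       }) [0..<dim_row L] y;
     x \<leftarrow> new_vec (dim_row L);
     x \<leftarrow> loop (\<lambda>i x. do {
         s \<leftarrow> dot [Suc i..<dim_row L] (\<lambda>j. L $$ (j,i)) (\<lambda>j. x $ j);
         a \<leftarrow> sub_op (y $ i) s;
         q \<leftarrow> div_op a (L $$ (i,i));
         ret (update_vec x i q)
       }) (rev [0..<dim_row L]) x;
     release (dim_row L);
     ret x
   }"

definition cholesky_solve_cols :: "real mat \<Rightarrow> real mat \<Rightarrow> real mat prog" where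
  "cholesky_solve_cols L R = do {
     X \<leftarrow> new_mat (dim_row L) (dim_col R);
     loop (\<lambda>k X. do {
         x \<leftarrow> cholesky_solve L (col R k);
         release (dim_row L);
         ret (replace_col X x k)
       }) [0..<dim_col R] X
   }"

text \<open>Sparse matrices are kept in compressed row format: the nonzero values, their column indices
  and the row pointers.\<close>

definition csr_size :: "nat \<Rightarrow> nat \<Rightarrow> nat" where
  "csr_size r nz = 2 * nz + r + 1"

definition sparse_mult :: "real mat \<Rightarrow> complex vec \<Rightarrow> complex vec prog" where
  "sparse_mult A x = do {
     y \<leftarrow> new_vec (dim_row A);
     loop (\<lambda>i y. do {
         s \<leftarrow> dot [j \<leftarrow> [0..<dim_col A]. A $$ (i,j) \<noteq> 0]
                (\<lambda>j. complex_of_real (A $$ (i,j))) (\<lambda>j. x $ j);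
         ret (update_vec y i s)
       }) [0..<dim_row A] y
   }"

definition joint_pattern :: "real mat \<Rightarrow> real mat \<Rightarrow> (nat \<times> nat) list" where
  "joint_pattern A B = [(i,j) \<leftarrow> List.product [0..<dim_row A] [0..<dim_col A].
     A $$ (i,j) \<noteq> 0 \<or> B $$ (i,j) \<noteq> 0]"

definition assemble_shifted :: "real mat \<Rightarrow> real mat \<Rightarrow> complex \<Rightarrow> complex mat prog" where
  "assemble_shifted M A \<sigma> = do {
     alloc (csr_size (dim_row M) (length (joint_pattern M A)));
     loop (\<lambda>(i,j) C. do {
         p \<leftarrow> mul_op \<sigma> (complex_of_real (A $$ (i,j)));
         c \<leftarrow> add_op (complex_of_real (M $$ (i,j))) p;
         ret (update_mat C (i,j) c)
       }) (joint_pattern M A) (0\<^sub>m (dim_row M) (dim_col M))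
   }"

text \<open>A subroutine that is used as a black box: its result, its operation count and the storage it
  occupies while it runs, each depending on the input.\<close>

datatype ('i, 'o) routine =
  Routine (result: "'i \<Rightarrow> 'o") (routine_ops: "'i \<Rightarrow> nat") (routine_mem: "'i \<Rightarrow> nat")

text \<open>\<open>n\<close> is the size of the output, which remains stored after the call.\<close>

definition call :: "('i, 'o) routine \<Rightarrow> 'i \<Rightarrow> nat \<Rightarrow> 'o prog" where
  "call R x n = do {
     alloc (routine_mem R x);
     tick (routine_ops R x);
     release (routine_mem R x);
     alloc n;
     ret (result R x)
   }"

text \<open>In Step 2 the program forms \<open>X = A\<^sub>t\<^sup>-\<^sup>1 F'\<^sup>T\<close>, the transpose of \<open>F' A\<^sub>t\<^sup>-\<^sup>1\<close> because \<open>A\<^sub>t\<close> is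
  symmetric.\<close>

definition bartels_stewart ::
  "(complex mat, complex mat \<times> complex mat) routine \<Rightarrow> (complex mat \<times> complex vec, complex vec) routine \<Rightarrow>
   real mat \<Rightarrow> real mat \<Rightarrow> real mat \<Rightarrow> real mat \<Rightarrow> real mat \<Rightarrow> complex vec prog" where
  "bartels_stewart schur solver A\<^sub>t M\<^sub>t M\<^sub>x A\<^sub>x F' = (let N = dim_row A\<^sub>t; m = dim_row M\<^sub>x in do {
     L \<leftarrow> cholesky A\<^sub>t;
     B \<leftarrow> cholesky_solve_cols L M\<^sub>t;
     (W, S) \<leftarrow> call schur (cmat B) (2 * (N * N));
     release (N * N);
     X \<leftarrow> cholesky_solve_cols L (transpose_mat F');
     V \<leftarrow> mat_cnj W;
     G \<leftarrow> mat_mult (transpose_mat (cmat X)) V;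
     release (N * N);
     release (N * m);
     Z \<leftarrow> new_mat m N;
     Z \<leftarrow> loop (\<lambda>k Z. do {
         alloc m;
         r \<leftarrow> loop (\<lambda>j r. do {
             y \<leftarrow> sparse_mult A\<^sub>x (col Z j);
             r \<leftarrow> loop (\<lambda>i r. do {
                 p \<leftarrow> mul_op (S $$ (k,j)) (y $ i);
                 a \<leftarrow> sub_op (r $ i) p;
                 ret (update_vec r i a)
               }) [0..<m] r;
             release m;
             ret r
           }) [Suc k..<N] (col G k);
         B \<leftarrow> assemble_shifted M\<^sub>x A\<^sub>x (S $$ (k,k));
         z \<leftarrow> call solver (B, r) m;
         release (csr_size m (length (joint_pattern M\<^sub>x A\<^sub>x)));
         release m;
         release m;
         ret (replace_col Z z k)
       }) (rev [0..<N]) Z;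
     U \<leftarrow> mat_mult Z (transpose_mat W);
     ret (stack_cols U)
   })"

text \<open>The input data \<open>A\<^sub>t\<close>, \<open>M\<^sub>t\<close>, \<open>M\<^sub>x\<close>, \<open>A\<^sub>x\<close> and the right-hand side are stored from the start.\<close>

definition input_size :: "nat \<Rightarrow> nat \<Rightarrow> real mat \<Rightarrow> real mat \<Rightarrow> nat" where
  "input_size N m M\<^sub>x A\<^sub>x = 2 * (N * N) + csr_size m (nnz M\<^sub>x) + csr_size m (nnz A\<^sub>x) + m * N"

definition run_from :: "nat \<Rightarrow> 'b prog \<Rightarrow> 'b \<times> usage" where
  "run_from s p = run_state p \<lparr>ops = 0, live = s, peak = s\<rparr>"

definition dense_schur_routine :: "(complex mat, complex mat \<times> complex mat) routine \<Rightarrow> bool" where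
  "dense_schur_routine R \<longleftrightarrow>
     (\<forall>N. \<forall>B\<in>carrier_mat N N. complex_schur N B (fst (result R B)) (snd (result R B))) \<and>
     (\<exists>c. \<forall>N. \<forall>B\<in>carrier_mat N N.
        real (routine_ops R B) \<le> c * real N ^ 3 \<and> real (routine_mem R B) \<le> c * real N ^ 2)"

definition uniquely_solvable :: "complex mat \<Rightarrow> complex vec \<Rightarrow> bool" where
  "uniquely_solvable B b \<longleftrightarrow> (\<exists>!z. z \<in> carrier_vec (dim_col B) \<and> B *\<^sub>v z = b)"

definition solves :: "(complex mat \<times> complex vec, complex vec) routine \<Rightarrow> complex mat \<Rightarrow> complex vec \<Rightarrow> bool" where
  "solves R B b \<longleftrightarrow> result R (B, b) \<in> carrier_vec (dim_col B) \<and> B *\<^sub>v result R (B, b) = b"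

end

theory Submission
  imports Defs
begin

text \<open>Write \<open>u\<close> as the stacked columns of \<open>U\<close>; the system becomes
  \<open>M\<^sub>x U A\<^sub>t + A\<^sub>x U M\<^sub>t\<^sup>T = F'\<close>.  Multiplying by \<open>A\<^sub>t\<^sup>-\<^sup>1\<close> and the conjugate of \<open>W\<close>
  from the right turns it into the triangular system \<open>M\<^sub>x Z + A\<^sub>x Z S\<^sup>T = G\<close> for \<open>Z\<close>, the product of \<open>U\<close> and
  the conjugate of \<open>W\<close>, which Step 3 solves from the last column to the first.  The diagonal entries of \<open>S\<close>
  are the eigenvalues of \<open>A\<^sub>t\<^sup>-\<^sup>1 M\<^sub>t\<close>; testing \<open>M\<^sub>t v = \<sigma> A\<^sub>t v\<close> with \<open>v\<close> gives \<open>Re \<sigma> > 0\<close>, hence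
  \<open>z\<^sup>* (M\<^sub>x + \<sigma> A\<^sub>x) z\<close> has positive real part for \<open>z \<noteq> 0\<close>.  Uniqueness makes \<open>U\<close> equal to its own
  conjugate, hence real.\<close>

section \<open>Reasoning about cost-instrumented programs\<close>

text \<open>Cost and correctness cannot be proved apart. The cost of the spatial solver is bounded
  only on matrices \<open>step3_matrix\<close> that stem from a genuine Schur decomposition of
  \<open>mat_inv A\<^sub>t * M\<^sub>t\<close>, and its result is meaningful only where the system
  is uniquely solvable. So the Cholesky phase must be shown to deliver exactly that product, and
  every loop carries its functional result along with its count. The predicate
  \<open>bartels_stewart_output\<close> is the interface: each output that it permits is proved
  correct, whatever decomposition was chosen, and the program is shown to produce such an output.

  The conjugate of W occurs because the temporal matrices act on U from the right, hence transposed: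
  with \<open>A\<^sub>t\<close> symmetric, the transpose of \<open>M\<^sub>t\<close> =
  \<open>A\<^sub>t\<close> W S W^* is conj(W) S^T W^T \<open>A\<^sub>t\<close>, and conj(W) and W^T
  are mutually inverse.

  The term m N^2 in the cost has two sources: dense work on m by N matrices and the O(N^2) sparse
  products \<open>A\<^sub>x\<close> z_j, each of cost O(m).\<close>

text \<open>The storage in use (\<open>l\<close> before, \<open>l'\<close> after) is tracked exactly, because \<open>release\<close> truncates
  at \<open>0\<close>; operations and peak storage are only bounded, by \<open>a\<close> and \<open>h\<close>.\<close>

definition triple :: "'b prog \<Rightarrow> nat \<Rightarrow> ('b \<Rightarrow> bool) \<Rightarrow> nat \<Rightarrow> nat \<Rightarrow> nat \<Rightarrow> bool" where
  "triple p l Q a l' h \<longleftrightarrow> (\<forall>s. live s = l \<longrightarrow> (case run_state p s of (v, s') \<Rightarrow>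
     Q v \<and> ops s' \<le> ops s + a \<and> live s' = l' \<and> peak s' \<le> max (peak s) h))"

lemma triple_conseq:
  assumes "triple p l Q a l' h" "\<And>v. Q v \<Longrightarrow> R v" "a \<le> b"
  shows "triple p l R b l' h"
  unfolding triple_def
proof (intro allI impI)
  fix s :: usage assume "live s = l"
  then show "case run_state p s of (v, s') \<Rightarrow>
     R v \<and> ops s' \<le> ops s + b \<and> live s' = l' \<and> peak s' \<le> max (peak s) h"
    using assms(1)[unfolded triple_def, rule_format, of s] assms(2,3) by (cases "run_state p s") auto
qed

text \<open>The peak bound \<open>h\<close> is an absolute ceiling, not an increment, so both parts
  share it and nothing has to be added; only allocating steps produce a condition such as
  \<open>l + n \<le> h\<close>.\<close>

lemma triple_bind:
  assumes "triple p l Q a l' h" "\<And>v. Q v \<Longrightarrow> triple (f v) l' R b l'' h"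
  shows "triple (p \<bind> f) l R (a + b) l'' h"
  unfolding triple_def
proof (intro allI impI)
  fix s :: usage assume s: "live s = l"
  obtain v s' where p: "run_state p s = (v, s')" by (cases "run_state p s")
  obtain w s'' where q: "run_state (f v) s' = (w, s'')" by (cases "run_state (f v) s'")
  have 1: "Q v" "ops s' \<le> ops s + a" "live s' = l'" "peak s' \<le> max (peak s) h"
    using assms(1) s p unfolding triple_def by auto
  have 2: "R w" "ops s'' \<le> ops s' + b" "live s'' = l''" "peak s'' \<le> max (peak s') h"
    using assms(2)[OF 1(1)] 1(3) q unfolding triple_def by auto
  show "case run_state (p \<bind> f) s of (v, s') \<Rightarrow>
     R v \<and> ops s' \<le> ops s + (a + b) \<and> live s' = l'' \<and> peak s' \<le> max (peak s) h"
    using 1 2 by (simp add: p q)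
qed

lemma triple_ret: "Q v \<Longrightarrow> triple (ret v) l Q 0 l h"
  by (simp add: triple_def)

lemma run_state_update [simp]: "run_state (State_Monad.update f) s = ((), f s)"
  by (simp add: State_Monad.update_def)

lemma triple_tick: "triple (tick n) l (\<lambda>_. True) n l h"
  by (simp add: triple_def tick_def)

lemma triple_alloc: "l + n \<le> h \<Longrightarrow> triple (alloc n) l (\<lambda>_. True) 0 (l + n) h"
  by (auto simp: triple_def alloc_def)

lemma triple_release: "triple (release n) l (\<lambda>_. True) 0 (l - n) h"
  by (simp add: triple_def release_def)

text \<open>Each primitive gets a rule fused with the bind that follows it. Applied by
  \<open>intro\<close>, these rules execute a program symbolically and build its cost as a
  right-nested sum; this is the origin of unsimplified counts such as
  \<open>2 * n + (1 + (1 + 0))\<close> in later statements.\<close>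

lemma triple_alloc_bind:
  "l + n \<le> h \<Longrightarrow> triple (f ()) (l + n) R a l' h \<Longrightarrow> triple (alloc n \<bind> f) l R a l' h"
  using triple_bind[OF triple_alloc, where f = f and R = R and b = a and l'' = l'] by simp

lemma triple_release_bind:
  "triple (f ()) (l - n) R a l' h \<Longrightarrow> triple (release n \<bind> f) l R a l' h"
  using triple_bind[OF triple_release, where f = f and R = R and b = a and l'' = l'] by simp

lemma triple_tick_bind:
  "triple (f ()) l R a l' h \<Longrightarrow> triple (tick n \<bind> f) l R (n + a) l' h"
  using triple_bind[OF triple_tick, where f = f and R = R and b = a and l'' = l'] by simp

lemma triple_new_vec_bind:
  "l + n \<le> h \<Longrightarrow> triple (f (0\<^sub>v n)) (l + n) R a l' h \<Longrightarrow> triple (new_vec n \<bind> f) l R a l' h"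
  by (simp add: new_vec_def triple_alloc_bind)

lemma triple_new_mat_bind:
  "l + r * c \<le> h \<Longrightarrow> triple (f (0\<^sub>m r c)) (l + r * c) R a l' h \<Longrightarrow> triple (new_mat r c \<bind> f) l R a l' h"
  by (simp add: new_mat_def triple_alloc_bind)

lemma triple_add_bind: "triple (f (x + y)) l R a l' h \<Longrightarrow> triple (add_op x y \<bind> f) l R (1 + a) l' h"
  by (simp add: add_op_def triple_tick_bind del: One_nat_def)

lemma triple_sub_bind: "triple (f (x - y)) l R a l' h \<Longrightarrow> triple (sub_op x y \<bind> f) l R (1 + a) l' h"
  by (simp add: sub_op_def triple_tick_bind del: One_nat_def)

lemma triple_mul_bind: "triple (f (x * y)) l R a l' h \<Longrightarrow> triple (mul_op x y \<bind> f) l R (1 + a) l' h"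
  by (simp add: mul_op_def triple_tick_bind del: One_nat_def)

lemma triple_div_bind: "triple (f (x div y)) l R a l' h \<Longrightarrow> triple (div_op x y \<bind> f) l R (1 + a) l' h"
  by (simp add: div_op_def triple_tick_bind del: One_nat_def)

lemma triple_sqrt_bind: "triple (f (sqrt x)) l R a l' h \<Longrightarrow> triple (sqrt_op x \<bind> f) l R (1 + a) l' h"
  by (simp add: sqrt_op_def triple_tick_bind del: One_nat_def)

lemma triple_cnj_bind: "triple (f (cnj x)) l R a l' h \<Longrightarrow> triple (cnj_op x \<bind> f) l R (1 + a) l' h"
  by (simp add: cnj_op_def triple_tick_bind del: One_nat_def)

lemma triple_call:
  assumes "l + routine_mem R x \<le> h" "l + n \<le> h" "Q (result R x)" "routine_ops R x \<le> a"
  shows "triple (call R x n) l Q a (l + n) h"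
proof -
  have "triple (call R x n) l Q (routine_ops R x + 0) (l + routine_mem R x - routine_mem R x + n) h"
    unfolding call_def
    by (intro triple_alloc_bind triple_tick_bind triple_release_bind triple_ret) (use assms in auto)
  then show ?thesis
    using assms(4) by (auto elim: triple_conseq)
qed

text \<open>The cost may differ from round to round. This matters for the sparse product, where a
  single row may be full and only the sum over all rows is controlled by \<open>nnz\<close>. The
  induction peels off the first round and shifts the index of the invariant.\<close>

lemma triple_loop_sum:
  assumes "\<And>n s. n < length xs \<Longrightarrow> I n s \<Longrightarrow> triple (f (xs ! n) s) l (I (Suc n)) (c n) l h" "I 0 s"
  shows "triple (loop f xs s) l (I (length xs)) (\<Sum>n<length xs. c n) l h"
  using assms
proof (induction xs arbitrary: I c s)
  case Nil
  then show ?case by (simp add: triple_ret)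
next
  case (Cons x xs)
  have "triple (f x s) l (I (Suc 0)) (c 0) l h"
    using Cons.prems(1)[of 0 s] Cons.prems(2) by simp
  moreover have "triple (loop f xs s') l (I (Suc (length xs))) (\<Sum>n<length xs. c (Suc n)) l h"
    if "I (Suc 0) s'" for s'
    using Cons.prems(1)[of "Suc _"] that by (intro Cons.IH[where I = "\<lambda>n. I (Suc n)"]) auto
  ultimately have "triple (loop f (x # xs) s) l (I (Suc (length xs))) (c 0 + (\<Sum>n<length xs. c (Suc n))) l h"
    by (auto intro: triple_bind)
  moreover have "(\<Sum>n<length (x # xs). c n) = c 0 + (\<Sum>n<length xs. c (Suc n))"
    by (simp add: sum.lessThan_Suc_shift del: sum.lessThan_Suc)
  ultimately show ?case by simp
qed

lemma triple_loop:
  assumes "\<And>n s. n < length xs \<Longrightarrow> I n s \<Longrightarrow> triple (f (xs ! n) s) l (I (Suc n)) c l h" "I 0 s"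
  shows "triple (loop f xs s) l (I (length xs)) (length xs * c) l h"
  using triple_loop_sum[where I = I and c = "\<lambda>_. c", OF assms] by simp

lemma triple_dot: "triple (dot xs a b) l (\<lambda>v. v = (\<Sum>j\<leftarrow>xs. a j * b j)) (2 * length xs) l h"
proof -
  have "triple (dot xs a b) l (\<lambda>v. v = (\<Sum>j\<leftarrow>take (length xs) xs. a j * b j)) (length xs * 2) l h"
    unfolding dot_def
  proof (rule triple_loop[where I = "\<lambda>n v. v = (\<Sum>j\<leftarrow>take n xs. a j * b j)"])
    fix n s assume "n < length xs" and s: "s = (\<Sum>j\<leftarrow>take n xs. a j * b j)"
    then have "triple (add_op s (a (xs ! n) * b (xs ! n))) l
        (\<lambda>v. v = (\<Sum>j\<leftarrow>take (Suc n) xs. a j * b j)) (1 + 0) l h"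
      unfolding add_op_def by (intro triple_tick_bind triple_ret) (simp add: take_Suc_conv_app_nth)
    then show "triple (mul_op (a (xs ! n)) (b (xs ! n)) \<bind> add_op s) l
        (\<lambda>v. v = (\<Sum>j\<leftarrow>take (Suc n) xs. a j * b j)) 2 l h"
      using triple_mul_bind[where f = "add_op s" and a = "1 + 0"] by (simp add: numeral_2_eq_2)
  qed simp
  then show ?thesis by (simp add: mult.commute)
qed

lemma triple_dot_upt_bind:
  assumes "triple (f (\<Sum>k\<in>{i..<j}. a k * b k)) l R c l' h" "j - i \<le> n"
  shows "triple (dot [i..<j] a b \<bind> f) l R (2 * n + c) l' h"
  using assms(2)
  by (intro triple_conseq[OF triple_bind[OF triple_dot]])
    (auto simp: interv_sum_list_conv_sum_set_nat intro: assms(1))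

text \<open>The program \<open>e i j\<close> has no access to the matrix being filled, so each entry
  is specified on its own. Dense products and conjugation have this form; the Cholesky
  factorization, which reads earlier entries of its own result, does not.\<close>

lemma loop_matrix_fill:
  assumes "\<And>i j C. i < r \<Longrightarrow> j < c \<Longrightarrow> triple (e i j) l (\<lambda>v. v = g i j) a l h"
  shows "triple (loop (\<lambda>i C. loop (\<lambda>j C. do {s \<leftarrow> e i j; ret (update_mat C (i,j) s)}) [0..<c] C) [0..<r] (0\<^sub>m r c))
    l (\<lambda>C. C = mat r c (\<lambda>(i,j). g i j)) (r * (c * a)) l h"
proof -
  have inner: "triple (loop (\<lambda>j C. do {s \<leftarrow> e i j; ret (update_mat C (i,j) s)}) [0..<c] C) l
      (\<lambda>C'. C' = mat r c (\<lambda>(i',j). if i' = i then g i j else C $$ (i',j))) (c * a) l h"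
    if "i < r" "C \<in> carrier_mat r c" for i C
  proof -
    have "triple (loop (\<lambda>j C. do {s \<leftarrow> e i j; ret (update_mat C (i,j) s)}) [0..<c] C) l
        (\<lambda>C'. C' = mat r c (\<lambda>(i',j). if i' = i \<and> j < length [0..<c] then g i j else C $$ (i',j)))
        (length [0..<c] * a) l h"
    proof (rule triple_loop[where I = "\<lambda>n C'. C' = mat r c (\<lambda>(i',j). if i' = i \<and> j < n then g i j else C $$ (i',j))"])
      fix n C'
      assume "n < length [0..<c]"
        and C': "C' = mat r c (\<lambda>(i',j). if i' = i \<and> j < n then g i j else C $$ (i',j))"
      then have "triple (do {s \<leftarrow> e i n; ret (update_mat C' (i,n) s)}) l
          (\<lambda>C'. C' = mat r c (\<lambda>(i',j). if i' = i \<and> j < Suc n then g i j else C $$ (i',j))) (a + 0) l h"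
        using that
        by (intro triple_bind[OF assms] triple_ret) (auto simp: update_mat_def less_Suc_eq)
      then show "triple (do {s \<leftarrow> e i ([0..<c] ! n); ret (update_mat C' (i,[0..<c] ! n) s)}) l
          (\<lambda>C'. C' = mat r c (\<lambda>(i',j). if i' = i \<and> j < Suc n then g i j else C $$ (i',j))) a l h"
        using \<open>n < length [0..<c]\<close> by simp
    qed (use that in auto)
    then show ?thesis
      by (rule triple_conseq) auto
  qed
  have "triple (loop (\<lambda>i C. loop (\<lambda>j C. do {s \<leftarrow> e i j; ret (update_mat C (i,j) s)}) [0..<c] C) [0..<r] (0\<^sub>m r c))
    l (\<lambda>C. C = mat r c (\<lambda>(i,j). if i < length [0..<r] then g i j else 0)) (length [0..<r] * (c * a)) l h"
  proof (rule triple_loop[where I = "\<lambda>n C. C = mat r c (\<lambda>(i,j). if i < n then g i j else 0)"])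
    fix n C
    assume "n < length [0..<r]" and "C = mat r c (\<lambda>(i,j). if i < n then g i j else 0)"
    then show "triple (loop (\<lambda>j C. do {s \<leftarrow> e ([0..<r] ! n) j; ret (update_mat C ([0..<r] ! n,j) s)}) [0..<c] C) l
        (\<lambda>C. C = mat r c (\<lambda>(i,j). if i < Suc n then g i j else 0)) (c * a) l h"
      by (intro triple_conseq[OF inner]) auto
  qed auto
  then show ?thesis
    by (rule triple_conseq) auto
qed

lemma triple_mat_mult:
  assumes "A \<in> carrier_mat r n" "B \<in> carrier_mat n c" "l + r * c \<le> h"
  shows "triple (mat_mult A B) l (\<lambda>C. C = A * B) (r * (c * (2 * n))) (l + r * c) h"
proof -
  let ?g = "\<lambda>i j. \<Sum>k\<leftarrow>[0..<n]. A $$ (i,k) * B $$ (k,j)"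
  have AB: "mat r c (\<lambda>(i,j). ?g i j) = A * B"
    using assms by (auto simp: times_mat_def scalar_prod_def interv_sum_list_conv_sum_set_nat)
  have "triple (dot [0..<n] (\<lambda>k. A $$ (i,k)) (\<lambda>k. B $$ (k,j))) l (\<lambda>v. v = ?g i j) (2 * n) l h" for i j l
    by (rule triple_conseq[OF triple_dot]) auto
  then have "triple (loop (\<lambda>i C. loop (\<lambda>j C. do {
         s \<leftarrow> dot [0..<n] (\<lambda>l. A $$ (i,l)) (\<lambda>l. B $$ (l,j));
         ret (update_mat C (i,j) s)
       }) [0..<c] C) [0..<r] (0\<^sub>m r c)) (l + r * c) (\<lambda>C. C = A * B) (r * (c * (2 * n))) (l + r * c) h"
    by (intro triple_conseq[OF loop_matrix_fill[where g = ?g]]) (auto simp: AB)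
  then show ?thesis
    using assms unfolding mat_mult_def by (intro triple_new_mat_bind) simp_all
qed

lemma triple_mat_cnj:
  assumes "A \<in> carrier_mat r c" "l + r * c \<le> h"
  shows "triple (mat_cnj A) l (\<lambda>C. C = map_mat cnj A) (r * c) (l + r * c) h"
proof -
  let ?g = "\<lambda>i j. cnj (A $$ (i,j))"
  have A: "mat r c (\<lambda>(i,j). ?g i j) = map_mat cnj A"
    using assms by auto
  have "triple (cnj_op x) l (\<lambda>v. v = cnj x) 1 l h" for x l
    using triple_cnj_bind[where f = ret, OF triple_ret, of "\<lambda>v. v = cnj x" x] by simp
  then have "triple (loop (\<lambda>i C. loop (\<lambda>j C. do {
         a \<leftarrow> cnj_op (A $$ (i,j));
         ret (update_mat C (i,j) a)
       }) [0..<c] C) [0..<r] (0\<^sub>m r c)) (l + r * c) (\<lambda>C. C = map_mat cnj A) (r * (c * 1)) (l + r * c) h"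
    by (intro triple_conseq[OF loop_matrix_fill[where g = ?g]]) (auto simp: A)
  then show ?thesis
    using assms unfolding mat_cnj_def by (intro triple_new_mat_bind) simp_all
qed

section \<open>Cholesky factorization\<close>

lemma quadratic_form_sum:
  fixes A :: "'b::comm_semiring_0 mat"
  assumes "A \<in> carrier_mat n n" "x \<in> carrier_vec n"
  shows "x \<bullet> (A *\<^sub>v x) = (\<Sum>i<n. \<Sum>k<n. x $ i * A $$ (i,k) * x $ k)"
  using assms by (auto simp: scalar_prod_def sum_distrib_left mult.assoc atLeast0LessThan intro!: sum.cong)

text \<open>The first \<open>j\<close> columns of \<open>L\<close> are those of a Cholesky factor of \<open>A\<close>; nothing is said about the
  entries above the diagonal.\<close>

definition cholesky_columns :: "nat \<Rightarrow> nat \<Rightarrow> real mat \<Rightarrow> real mat \<Rightarrow> bool" where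
  "cholesky_columns n j A L \<longleftrightarrow> L \<in> carrier_mat n n \<and> (\<forall>k<j. 0 < L $$ (k,k)) \<and>
     (\<forall>k<j. \<forall>i\<in>{k..<n}. A $$ (i,k) = (\<Sum>l<Suc k. L $$ (i,l) * L $$ (k,l)))"

text \<open>Back substitution: once the entries of larger index are known, equation \<open>k\<close>
  can be solved for \<open>x k\<close> because \<open>L k k \<noteq> 0\<close>, and the equations of
  larger index do not contain \<open>x k\<close>. The entry \<open>x j\<close> is free and
  normalised to 1.\<close>

lemma transposed_triangular_solution_exists:
  fixes L :: "nat \<Rightarrow> nat \<Rightarrow> 'b::field"
  assumes "\<And>k. k < j \<Longrightarrow> L k k \<noteq> 0"
  shows "\<exists>x. x j = 1 \<and> (\<forall>k<j. (\<Sum>l=k..j. L l k * x l) = 0)"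
proof -
  \<comment> \<open>Here \<open>d\<close> counts the equations already solved, from
    \<open>k = j - 1\<close> downwards.\<close>
  have "\<exists>x. x j = 1 \<and> (\<forall>k<j. j \<le> k + d \<longrightarrow> (\<Sum>l=k..j. L l k * x l) = 0)" for d
  proof (induction d)
    case 0
    then show ?case by (intro exI[of _ "\<lambda>_. 1"]) auto
  next
    case (Suc d)
    then obtain x where x: "x j = 1" "\<And>k. k < j \<Longrightarrow> j \<le> k + d \<Longrightarrow> (\<Sum>l=k..j. L l k * x l) = 0"
      by blast
    show ?case
    proof (cases "d < j")
      case False
      then show ?thesis using x by auto
    next
      case True
      define k where "k = j - Suc d"
      have k: "k < j" "j = k + Suc d" using True by (auto simp: k_def)
      define x' where "x' = x(k := - (\<Sum>l=Suc k..j. L l k * x l) / L k k)"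
      have x'_eq: "(\<Sum>l=i..j. L l i' * x' l) = (\<Sum>l=i..j. L l i' * x l)" if "k < i" for i i'
        using that by (intro sum.cong) (auto simp: x'_def)
      have "(\<Sum>l=i..j. L l i * x' l) = 0" if i: "i < j" "j \<le> i + Suc d" for i
      proof (cases "i = k")
        case True
        have "(\<Sum>l=k..j. L l k * x' l) = L k k * x' k + (\<Sum>l=Suc k..j. L l k * x' l)"
          using k(1) by (simp add: sum.atLeast_Suc_atMost)
        also have "\<dots> = 0"
          using assms[OF k(1)] by (simp add: x'_eq) (simp add: x'_def)
        finally show ?thesis using True by simp
      next
        case False
        then have "k < i" "j \<le> i + d" using i(2) k(2) by auto
        then show ?thesis using x(2)[OF i(1)] x'_eq[of i i] by simp
      qed
      moreover have "x' j = 1" using k x(1) by (simp add: x'_def)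
      ultimately show ?thesis by blast
    qed
  qed
  from this[of j] show ?thesis by auto
qed

text \<open>The pivot is the value of the quadratic form at the vector \<open>x\<close> with \<open>x\<^sub>j = 1\<close>, zero
  entries below, that annihilates the first \<open>j\<close> columns of \<open>L\<close>.\<close>

lemma cholesky_pivot_pos:
  assumes A: "spd n A" and L: "cholesky_columns n j A L" and j: "j < n"
  shows "0 < A $$ (j,j) - (\<Sum>k<j. L $$ (j,k) * L $$ (j,k))" (is "0 < ?d")
proof -
  define Lz where "Lz i l = (if l \<le> i then L $$ (i,l) else 0)" for i l
  have AC: "A \<in> carrier_mat n n"
    and pd: "\<And>x. x \<in> carrier_vec n \<Longrightarrow> x \<noteq> 0\<^sub>v n \<Longrightarrow> 0 < x \<bullet> (A *\<^sub>v x)"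
    and sym: "transpose_mat A = A"
    using A unfolding spd_def positive_definite_def by auto
  have sym: "A $$ (i,k) = A $$ (k,i)" if "i < n" "k < n" for i k
    using arg_cong[OF sym, of "\<lambda>A. A $$ (i,k)"] that AC by auto
  have Lpos: "\<And>k. k < j \<Longrightarrow> 0 < L $$ (k,k)"
    and LA: "\<And>i k. k < j \<Longrightarrow> k \<le> i \<Longrightarrow> i < n \<Longrightarrow> A $$ (i,k) = (\<Sum>l<Suc k. L $$ (i,l) * L $$ (k,l))"
    using L unfolding cholesky_columns_def by auto
  have "\<exists>x. x j = 1 \<and> (\<forall>k<j. (\<Sum>l=k..j. L $$ (l,k) * x l) = 0)"
    by (rule transposed_triangular_solution_exists[of j "\<lambda>l k. L $$ (l,k)"]) (use Lpos in force)
  then obtain x where x: "x j = (1::real)" "\<And>k. k < j \<Longrightarrow> (\<Sum>l=k..j. L $$ (l,k) * x l) = 0"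
    by blast
  define v where "v = vec n (\<lambda>i. if i \<le> j then x i else 0)"
  have v: "v \<in> carrier_vec n" "v $ j = 1" "v \<noteq> 0\<^sub>v n"
    using j x(1) by (auto simp: v_def dest: arg_cong[of _ _ "\<lambda>v. v $ j"])
  \<comment> \<open>On the leading block of order \<open>j + 1\<close> the \<open>j\<close> finished
    columns, cut off above the diagonal, reproduce \<open>A\<close> except at the corner, where
    exactly the pivot \<open>?d\<close> is missing. This is the lower triangle; symmetry then
    supplies the other half.\<close>
  have entry: "A $$ (i,k) = (\<Sum>l<j. Lz i l * Lz k l) + (if i = j \<and> k = j then ?d else 0)"
    if "i \<le> j" "k \<le> i" for i k
  proof (cases "k = j")
    case True
    then show ?thesis using that by (simp add: Lz_def)
  next
    case False
    then have k: "k < j" using that by simp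
    have "(\<Sum>l<j. Lz i l * Lz k l) = (\<Sum>l<Suc k. L $$ (i,l) * L $$ (k,l))"
      using k that by (intro sum.mono_neutral_cong_right) (auto simp: Lz_def)
    then show ?thesis using LA[OF k that(2)] that j k by simp
  qed
  have entry: "A $$ (i,k) = (\<Sum>l<j. Lz i l * Lz k l) + (if i = j \<and> k = j then ?d else 0)"
    if "i \<le> j" "k \<le> j" for i k
    using entry[of i k] entry[of k i] sym[of i k] that j by (cases "k \<le> i") (auto simp: mult.commute)
  have col: "(\<Sum>i<n. v $ i * Lz i l) = 0" if "l < j" for l
  proof -
    have "(\<Sum>i<n. v $ i * Lz i l) = (\<Sum>i=l..j. L $$ (i,l) * x i)"
      using j by (intro sum.mono_neutral_cong_right) (auto simp: Lz_def v_def)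
    then show ?thesis using x(2)[OF that] by simp
  qed
  have "v \<bullet> (A *\<^sub>v v) = (\<Sum>i<n. \<Sum>k<n. v $ i * A $$ (i,k) * v $ k)"
    by (rule quadratic_form_sum[OF AC v(1)])
  also have "\<dots> = (\<Sum>i<n. \<Sum>k<n. v $ i * ((\<Sum>l<j. Lz i l * Lz k l) + (if i = j \<and> k = j then ?d else 0)) * v $ k)"
  proof (intro sum.cong refl)
    fix i k assume "i \<in> {..<n}" "k \<in> {..<n}"
    then show "v $ i * A $$ (i,k) * v $ k =
        v $ i * ((\<Sum>l<j. Lz i l * Lz k l) + (if i = j \<and> k = j then ?d else 0)) * v $ k"
      using entry[of i k] by (cases "i \<le> j \<and> k \<le> j") (auto simp: v_def)
  qed
  also have "\<dots> = (\<Sum>i<n. \<Sum>k<n. \<Sum>l<j. (v $ i * Lz i l) * (v $ k * Lz k l))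
      + (\<Sum>i<n. \<Sum>k<n. if i = j \<and> k = j then ?d else 0)"
    unfolding sum.distrib[symmetric]
    by (intro sum.cong refl) (use v(2) in \<open>auto simp: sum_distrib_left sum_distrib_right algebra_simps\<close>)
  also have "(\<Sum>i<n. \<Sum>k<n. if i = j \<and> k = j then ?d else 0) = ?d"
  proof -
    have "(\<Sum>k<n. if i = j \<and> k = j then ?d else 0) = (if i = j then ?d else 0)" for i
      using j by (cases "i = j") auto
    then show ?thesis using j by simp
  qed
  \<comment> \<open>This part is the sum of the squares of the products of \<open>v\<close> with the
    first \<open>j\<close> columns of \<open>Lz\<close>. All of them vanish by the choice of
    \<open>v\<close>, so only the corner term \<open>?d\<close> survives.\<close>
  also have "(\<Sum>i<n. \<Sum>k<n. \<Sum>l<j. (v $ i * Lz i l) * (v $ k * Lz k l))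
      = (\<Sum>l<j. (\<Sum>i<n. v $ i * Lz i l) * (\<Sum>k<n. v $ k * Lz k l))"
    unfolding sum_product by (subst sum.swap[of _ "{..<n}" "{..<j}", symmetric]) (intro sum.cong sum.swap refl)
  also have "\<dots> = 0" using col by simp
  finally show ?thesis using pd[OF v(1,3)] by simp
qed

lemma triple_cholesky:
  assumes A: "spd n A" and h: "l + n * n \<le> h"
  shows "triple (cholesky A) l (cholesky_columns n n A) (n * (2 * n + 2 + n * (2 * n + 2))) (l + n * n) h"
proof -
  have n: "A \<in> carrier_mat n n" using A by (simp add: spd_def positive_definite_def)
  let ?q = "\<lambda>j L r i. (A $$ (i,j) - (\<Sum>k=0..<j. L $$ (i,k) * L $$ (j,k))) / r"
  \<comment> \<open>The new entries of column \<open>j\<close> are computed from columns of index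
    less than \<open>j\<close>, which this loop never writes. Hence all of them can be expressed
    through the initial \<open>L0\<close>.\<close>
  have column: "triple (loop (\<lambda>i L. do {
             s \<leftarrow> dot [0..<j] (\<lambda>k. L $$ (i,k)) (\<lambda>k. L $$ (j,k));
             a \<leftarrow> sub_op (A $$ (i,j)) s;
             q \<leftarrow> div_op a r;
             ret (update_mat L (i,j) q)
           }) [Suc j..<n] L0) l
         (\<lambda>L. L \<in> carrier_mat n n \<and> (\<forall>i<n. \<forall>k<n. L $$ (i,k) = (if k = j \<and> j < i then ?q j L0 r i else L0 $$ (i,k))))
         (n * (2 * n + 2)) l h"
    if j: "j < n" and L0: "L0 \<in> carrier_mat n n" for j L0 r l
  proof -
    let ?I = "\<lambda>c L. L \<in> carrier_mat n n \<and> (\<forall>i<n. \<forall>k<n. L $$ (i,k) =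
      (if k = j \<and> j < i \<and> i < Suc j + c then ?q j L0 r i else L0 $$ (i,k)))"
    have "triple (loop (\<lambda>i L. do {
             s \<leftarrow> dot [0..<j] (\<lambda>k. L $$ (i,k)) (\<lambda>k. L $$ (j,k));
             a \<leftarrow> sub_op (A $$ (i,j)) s;
             q \<leftarrow> div_op a r;
             ret (update_mat L (i,j) q)
           }) [Suc j..<n] L0) l (?I (length [Suc j..<n])) (length [Suc j..<n] * (2 * n + (1 + (1 + 0)))) l h"
    proof (rule triple_loop[where I = ?I])
      fix c L assume c: "c < length [Suc j..<n]" and L: "?I c L"
      define i where "i = Suc j + c"
      have i: "i < n" "[Suc j..<n] ! c = i" using c by (auto simp: i_def)
      have "(\<Sum>k=0..<j. L $$ (i,k) * L $$ (j,k)) = (\<Sum>k=0..<j. L0 $$ (i,k) * L0 $$ (j,k))"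
        using L i j by (intro sum.cong) auto
      then have "?I (Suc c) (update_mat L (i,j) ((A $$ (i,j) - (\<Sum>k=0..<j. L $$ (i,k) * L $$ (j,k))) / r))"
        using L i j by (auto simp: update_mat_def i_def less_Suc_eq)
      then show "triple (do {
             s \<leftarrow> dot [0..<j] (\<lambda>k. L $$ ([Suc j..<n] ! c,k)) (\<lambda>k. L $$ (j,k));
             a \<leftarrow> sub_op (A $$ ([Suc j..<n] ! c,j)) s;
             q \<leftarrow> div_op a r;
             ret (update_mat L ([Suc j..<n] ! c,j) q)
           }) l (?I (Suc c)) (2 * n + (1 + (1 + 0))) l h"
        unfolding i(2) by (intro triple_dot_upt_bind triple_sub_bind triple_div_bind triple_ret) (use j in auto)
    qed (use L0 in auto)
    note inner = this
    have bound: "length [Suc j..<n] * (2 * n + (1 + (1 + 0))) \<le> n * (2 * n + 2)"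
      by (intro mult_le_mono) auto
    show ?thesis
      by (rule triple_conseq[OF inner _ bound]) auto
  qed
  have "triple (loop (\<lambda>j L. do {
         s \<leftarrow> dot [0..<j] (\<lambda>k. L $$ (j,k)) (\<lambda>k. L $$ (j,k));
         d \<leftarrow> sub_op (A $$ (j,j)) s;
         r \<leftarrow> sqrt_op d;
         loop (\<lambda>i L. do {
             s \<leftarrow> dot [0..<j] (\<lambda>k. L $$ (i,k)) (\<lambda>k. L $$ (j,k));
             a \<leftarrow> sub_op (A $$ (i,j)) s;
             q \<leftarrow> div_op a r;
             ret (update_mat L (i,j) q)
           }) [Suc j..<n] (update_mat L (j,j) r)
       }) [0..<n] (0\<^sub>m n n)) (l + n * n) (cholesky_columns n (length [0..<n]) A)
       (length [0..<n] * (2 * n + (1 + (1 + n * (2 * n + 2))))) (l + n * n) h"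
  proof (rule triple_loop[where I = "\<lambda>j. cholesky_columns n j A"])
    fix c L assume c: "c < length [0..<n]" and L: "cholesky_columns n c A L"
    then have j: "c < n" "[0..<n] ! c = c" by auto
    have LC: "L \<in> carrier_mat n n" and Lpos: "\<And>k. k < c \<Longrightarrow> 0 < L $$ (k,k)"
      and LA: "\<And>i k. k < c \<Longrightarrow> k \<le> i \<Longrightarrow> i < n \<Longrightarrow> A $$ (i,k) = (\<Sum>l<Suc k. L $$ (i,l) * L $$ (k,l))"
      using L unfolding cholesky_columns_def by auto
    let ?d = "A $$ (c,c) - (\<Sum>k=0..<c. L $$ (c,k) * L $$ (c,k))"
    \<comment> \<open>Positivity makes the square of \<open>sqrt ?d\<close> equal to
      \<open>?d\<close> and the division by it legitimate.\<close>
    have d: "0 < ?d"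
      using cholesky_pivot_pos[OF A L j(1)] by (simp add: atLeast0LessThan)
    let ?L0 = "update_mat L (c,c) (sqrt ?d)"
    have L0C: "?L0 \<in> carrier_mat n n" using LC by (auto simp: update_mat_def)
    have L0cc: "?L0 $$ (c,c) = sqrt ?d" using LC j by simp
    have result: "cholesky_columns n (Suc c) A L'"
      if "L' \<in> carrier_mat n n \<and>
        (\<forall>i<n. \<forall>k<n. L' $$ (i,k) = (if k = c \<and> c < i then ?q c ?L0 (sqrt ?d) i else ?L0 $$ (i,k)))" for L'
    proof -
      from that have L'C: "L' \<in> carrier_mat n n"
        and L': "\<forall>i<n. \<forall>k<n. L' $$ (i,k) = (if k = c \<and> c < i then ?q c ?L0 (sqrt ?d) i else ?L0 $$ (i,k))"
        by auto
      have old: "L' $$ (i,k) = L $$ (i,k)" if "k < c" "i < n" for i k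
        using L' that j LC by auto
      have diag: "L' $$ (c,c) = sqrt ?d"
        using L' j L0cc by auto
      have new: "L' $$ (i,c) * sqrt ?d = A $$ (i,c) - (\<Sum>k=0..<c. L $$ (i,k) * L $$ (c,k))" if "c < i" "i < n" for i
      proof -
        have sums: "(\<Sum>k=0..<c. ?L0 $$ (i,k) * ?L0 $$ (c,k)) = (\<Sum>k=0..<c. L $$ (i,k) * L $$ (c,k))"
          using LC j that by (intro sum.cong) auto
        have ratio: "L' $$ (i,c) = ?q c ?L0 (sqrt ?d) i"
          using L'[rule_format, OF that(2) j(1)] that(1) by (simp only: simp_thms if_True)
        have nonzero: "sqrt ?d \<noteq> 0"
          using d by (simp only: real_sqrt_eq_zero_cancel_iff less_imp_neq[symmetric] not_False_eq_True)
        show ?thesis using ratio unfolding sums nonzero_eq_divide_eq[OF nonzero] .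
      qed
      have now: "A $$ (i,c) = (\<Sum>l<Suc c. L' $$ (i,l) * L' $$ (c,l))" if i: "c \<le> i" "i < n" for i
      proof -
        have "(\<Sum>l<Suc c. L' $$ (i,l) * L' $$ (c,l)) = (\<Sum>l<c. L $$ (i,l) * L $$ (c,l)) + L' $$ (i,c) * L' $$ (c,c)"
          using old i j by simp
        also have "\<dots> = A $$ (i,c)"
        proof (cases "i = c")
          case True
          then show ?thesis using diag d by (simp add: atLeast0LessThan)
        next
          case False
          then show ?thesis using new[of i] i diag by (simp add: atLeast0LessThan)
        qed
        finally show ?thesis by simp
      qed
      have before: "A $$ (i,k) = (\<Sum>l<Suc k. L' $$ (i,l) * L' $$ (k,l))" if "k < c" "k \<le> i" "i < n" for i k
      proof -
        have "(\<Sum>l<Suc k. L' $$ (i,l) * L' $$ (k,l)) = (\<Sum>l<Suc k. L $$ (i,l) * L $$ (k,l))"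
          using that j old by (intro sum.cong) auto
        then show ?thesis using LA[OF that] by simp
      qed
      show ?thesis
        unfolding cholesky_columns_def
      proof (intro conjI allI impI ballI)
        fix k assume "k < Suc c"
        then show "0 < L' $$ (k,k)"
          using Lpos[of k] old[of k k] diag d j by (cases "k = c") auto
      next
        fix k i assume "k < Suc c" "i \<in> {k..<n}"
        then show "A $$ (i,k) = (\<Sum>l<Suc k. L' $$ (i,l) * L' $$ (k,l))"
          using now[of i] before[of k i] by (cases "k = c") (simp_all del: sum.lessThan_Suc)
      qed (rule L'C)
    qed
    show "triple (do {
         s \<leftarrow> dot [0..<[0..<n] ! c] (\<lambda>k. L $$ ([0..<n] ! c,k)) (\<lambda>k. L $$ ([0..<n] ! c,k));
         d \<leftarrow> sub_op (A $$ ([0..<n] ! c,[0..<n] ! c)) s;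
         r \<leftarrow> sqrt_op d;
         loop (\<lambda>i L. do {
             s \<leftarrow> dot [0..<[0..<n] ! c] (\<lambda>k. L $$ (i,k)) (\<lambda>k. L $$ ([0..<n] ! c,k));
             a \<leftarrow> sub_op (A $$ (i,[0..<n] ! c)) s;
             q \<leftarrow> div_op a r;
             ret (update_mat L (i,[0..<n] ! c) q)
           }) [Suc ([0..<n] ! c)..<n] (update_mat L ([0..<n] ! c,[0..<n] ! c) r)
       }) (l + n * n) (cholesky_columns n (Suc c) A) (2 * n + (1 + (1 + n * (2 * n + 2)))) (l + n * n) h"
      unfolding j(2)
      by (intro triple_dot_upt_bind triple_sub_bind triple_sqrt_bind
          triple_conseq[OF column[OF j(1) L0C] result order_refl]) (use j in simp_all)
  qed (simp add: cholesky_columns_def)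
  from triple_conseq[OF this, of "cholesky_columns n n A" "n * (2 * n + 2 + n * (2 * n + 2))"]
  show ?thesis
    using h unfolding cholesky_def carrier_matD[OF n]
    by (intro triple_new_mat_bind) simp_all
qed

text \<open>Definiteness excludes a kernel, so the determinant is nonzero and
  \<open>mat_inverse\<close> returns \<open>Some\<close>; the \<open>the\<close> hidden in
  \<open>mat_inv\<close> is therefore harmless.\<close>

lemma positive_definite_inverse:
  assumes "positive_definite n A"
  shows "A * mat_inv A = 1\<^sub>m n" "mat_inv A * A = 1\<^sub>m n" "mat_inv A \<in> carrier_mat n n"
proof -
  have A: "A \<in> carrier_mat n n" using assms by (simp add: positive_definite_def)
  have "A *\<^sub>v v \<noteq> 0\<^sub>v n" if "v \<in> carrier_vec n" "v \<noteq> 0\<^sub>v n" for v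
    using assms that by (auto simp: positive_definite_def)
  then have "det A \<noteq> 0"
    unfolding det_0_iff_vec_prod_zero_field[OF A] by blast
  then obtain B where "mat_inverse A = Some B"
    using det_non_zero_imp_unit[OF A, of "()"] mat_inverse(1)[OF A, of "()"] by (cases "mat_inverse A") auto
  then show "A * mat_inv A = 1\<^sub>m n" "mat_inv A * A = 1\<^sub>m n" "mat_inv A \<in> carrier_mat n n"
    using mat_inverse(2)[OF A] by auto
qed

text \<open>The invariant covers the lower triangle and the symmetry of \<open>A\<close> the upper
  one; together they give the factorization A = Lz Lz^T.\<close>

lemma cholesky_columns_entry:
  assumes A: "spd n A" and L: "cholesky_columns n n A L" and "i < n" "k < n"
  defines "Lz \<equiv> \<lambda>i l. if l \<le> i then L $$ (i,l) else 0"
  shows "A $$ (i,k) = (\<Sum>l<n. Lz i l * Lz k l)"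
proof -
  have low: "A $$ (i,k) = (\<Sum>l<n. Lz i l * Lz k l)" if "k \<le> i" "i < n" for i k
  proof -
    have "(\<Sum>l<n. Lz i l * Lz k l) = (\<Sum>l<Suc k. L $$ (i,l) * L $$ (k,l))"
      using that by (intro sum.mono_neutral_cong_right) (auto simp: Lz_def)
    then show ?thesis using L that by (auto simp: cholesky_columns_def simp del: sum.lessThan_Suc)
  qed
  have "A $$ (i,k) = A $$ (k,i)"
    using A assms(3,4) by (metis carrier_matD index_transpose_mat(1) spd_def positive_definite_def)
  then show ?thesis
    using low[of k i] low[of i k] assms(3,4) by (cases "k \<le> i") (auto simp: mult.commute)
qed

text \<open>Forward substitution yields L y = b, backward substitution L^T x = y, hence A x = L L^T
  x = b. The vector \<open>y\<close> stays allocated until \<open>x\<close> is complete, which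
  accounts for \<open>2 * n\<close> in the storage condition.\<close>

lemma triple_cholesky_solve:
  assumes A: "spd n A" and L: "cholesky_columns n n A L" and b: "b \<in> carrier_vec n" and h: "l + 2 * n \<le> h"
  shows "triple (cholesky_solve L b) l (\<lambda>x. x \<in> carrier_vec n \<and> A *\<^sub>v x = b) (2 * (n * (2 * n + 2))) (l + n) h"
proof -
  have AC: "A \<in> carrier_mat n n" using A by (simp add: spd_def positive_definite_def)
  have LC: "L \<in> carrier_mat n n" and Lpos: "\<And>k. k < n \<Longrightarrow> 0 < L $$ (k,k)"
    using L by (auto simp: cholesky_columns_def)
  let ?F = "\<lambda>c y. y \<in> carrier_vec n \<and> (\<forall>i<c. (\<Sum>j<Suc i. L $$ (i,j) * y $ j) = b $ i)"
  \<comment> \<open>The backward loop runs through the indices downwards: after \<open>c\<close>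
    rounds the equations of index at least n - c hold. Writing \<open>n \<le> i + c\<close> avoids
    truncated subtraction.\<close>
  let ?B = "\<lambda>y c x. x \<in> carrier_vec n \<and> (\<forall>i<n. n \<le> i + c \<longrightarrow> (\<Sum>j=i..<n. L $$ (j,i) * x $ j) = y $ i)"
  have forward: "triple (loop (\<lambda>i y. do {
         s \<leftarrow> dot [0..<i] (\<lambda>j. L $$ (i,j)) (\<lambda>j. y $ j);
         a \<leftarrow> sub_op (b $ i) s;
         q \<leftarrow> div_op a (L $$ (i,i));
         ret (update_vec y i q)
       }) [0..<n] (0\<^sub>v n)) l (?F (length [0..<n])) (length [0..<n] * (2 * n + (1 + (1 + 0)))) l h" for l
  proof (rule triple_loop[where I = ?F])
    fix c y assume "c < length [0..<n]" and y: "?F c y"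
    then have c: "c < n" "[0..<n] ! c = c" by auto
    let ?q = "(b $ c - (\<Sum>j=0..<c. L $$ (c,j) * y $ j)) / L $$ (c,c)"
    have "(\<Sum>j<Suc i. L $$ (i,j) * update_vec y c ?q $ j) = b $ i" if i: "i < Suc c" for i
    proof (cases "i = c")
      case True
      have "(\<Sum>j<c. L $$ (c,j) * update_vec y c ?q $ j) = (\<Sum>j<c. L $$ (c,j) * y $ j)"
        by (intro sum.cong) auto
      then show ?thesis
        using True Lpos[OF c(1)] y c by (simp add: atLeast0LessThan carrier_vecD[of y n])
    next
      case False
      then have "(\<Sum>j<Suc i. L $$ (i,j) * update_vec y c ?q $ j) = (\<Sum>j<Suc i. L $$ (i,j) * y $ j)"
        using i by (intro sum.cong) auto
      then show ?thesis using y i False by (simp del: sum.lessThan_Suc)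
    qed
    then have "?F (Suc c) (update_vec y c ?q)"
      using y by (auto simp: update_vec_def simp del: sum.lessThan_Suc)
    then show "triple (do {
         s \<leftarrow> dot [0..<[0..<n] ! c] (\<lambda>j. L $$ ([0..<n] ! c,j)) (\<lambda>j. y $ j);
         a \<leftarrow> sub_op (b $ ([0..<n] ! c)) s;
         q \<leftarrow> div_op a (L $$ ([0..<n] ! c,[0..<n] ! c));
         ret (update_vec y ([0..<n] ! c) q)
       }) l (?F (Suc c)) (2 * n + (1 + (1 + 0))) l h"
      unfolding c(2)
      by (intro triple_dot_upt_bind triple_sub_bind triple_div_bind triple_ret) (use c in simp_all)
  qed auto
  have backward: "triple (loop (\<lambda>i x. do {
         s \<leftarrow> dot [Suc i..<n] (\<lambda>j. L $$ (j,i)) (\<lambda>j. x $ j);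
         a \<leftarrow> sub_op (y $ i) s;
         q \<leftarrow> div_op a (L $$ (i,i));
         ret (update_vec x i q)
       }) (rev [0..<n]) (0\<^sub>v n)) l (?B y (length (rev [0..<n]))) (length (rev [0..<n]) * (2 * n + (1 + (1 + 0)))) l h" for y l
  proof (rule triple_loop[where I = "?B y"])
    fix c x assume "c < length (rev [0..<n])" and x: "?B y c x"
    then have "c < n" by simp
    then obtain i where i: "i < n" "n = Suc (i + c)" "rev [0..<n] ! c = i"
      using that[of "n - Suc c"] by (simp add: rev_nth)
    let ?q = "(y $ i - (\<Sum>j=Suc i..<n. L $$ (j,i) * x $ j)) / L $$ (i,i)"
    have "(\<Sum>j=k..<n. L $$ (j,k) * update_vec x i ?q $ j) = y $ k" if k: "k < n" "n \<le> k + Suc c" for k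
    proof (cases "k = i")
      case True
      have "(\<Sum>j=Suc i..<n. L $$ (j,i) * update_vec x i ?q $ j) = (\<Sum>j=Suc i..<n. L $$ (j,i) * x $ j)"
        by (intro sum.cong) auto
      then show ?thesis
        using True Lpos[OF i(1)] x i(1) by (simp add: sum.atLeast_Suc_lessThan carrier_vecD[of x n])
    next
      case False
      then have "(\<Sum>j=k..<n. L $$ (j,k) * update_vec x i ?q $ j) = (\<Sum>j=k..<n. L $$ (j,k) * x $ j)"
        using i k by (intro sum.cong) auto
      moreover have "n \<le> k + c" using k i(2) False by linarith
      ultimately show ?thesis using x k(1) by (simp only:)
    qed
    then have "?B y (Suc c) (update_vec x i ?q)"
      using x by (auto simp: update_vec_def)
    then show "triple (do {
         s \<leftarrow> dot [Suc (rev [0..<n] ! c)..<n] (\<lambda>j. L $$ (j,rev [0..<n] ! c)) (\<lambda>j. x $ j);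
         a \<leftarrow> sub_op (y $ (rev [0..<n] ! c)) s;
         q \<leftarrow> div_op a (L $$ (rev [0..<n] ! c,rev [0..<n] ! c));
         ret (update_vec x (rev [0..<n] ! c) q)
       }) l (?B y (Suc c)) (2 * n + (1 + (1 + 0))) l h"
      unfolding i(3)
      by (intro triple_dot_upt_bind triple_sub_bind triple_div_bind triple_ret) simp_all
  qed auto
  have solution: "A *\<^sub>v x = b"
    if y: "?F (length [0..<n]) y" and x: "?B y (length (rev [0..<n])) x" for x y
  proof (rule eq_vecI)
    let ?Lz = "\<lambda>i l. if l \<le> i then L $$ (i,l) else 0"
    fix i assume "i < dim_vec b"
    then have i: "i < n" using b by simp
    have col: "(\<Sum>k<n. ?Lz k l * x $ k) = y $ l" if "l < n" for l
    proof -
      have "(\<Sum>k<n. ?Lz k l * x $ k) = (\<Sum>k=l..<n. L $$ (k,l) * x $ k)"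
        by (intro sum.mono_neutral_cong_right) auto
      then show ?thesis using x that by auto
    qed
    have "(A *\<^sub>v x) $ i = (\<Sum>k<n. A $$ (i,k) * x $ k)"
      using AC x i by (auto simp: scalar_prod_def atLeast0LessThan)
    also have "\<dots> = (\<Sum>k<n. \<Sum>l<n. ?Lz i l * (?Lz k l * x $ k))"
      using cholesky_columns_entry[OF A L i] by (intro sum.cong refl) (simp only: lessThan_iff sum_distrib_right mult.assoc)
    also have "\<dots> = (\<Sum>l<n. ?Lz i l * (\<Sum>k<n. ?Lz k l * x $ k))"
      by (subst sum.swap) (simp only: sum_distrib_left)
    also have "\<dots> = (\<Sum>l<n. ?Lz i l * y $ l)"
      using col by (intro sum.cong) auto
    also have "\<dots> = (\<Sum>l<Suc i. L $$ (i,l) * y $ l)"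
      using i by (intro sum.mono_neutral_cong_right) auto
    also have "\<dots> = b $ i" using y i by (simp del: sum.lessThan_Suc)
    finally show "(A *\<^sub>v x) $ i = b $ i" .
  qed (use AC b in auto)
  have "triple (cholesky_solve L b) l (\<lambda>x. x \<in> carrier_vec n \<and> A *\<^sub>v x = b)
      (length [0..<n] * (2 * n + (1 + (1 + 0))) + (length (rev [0..<n]) * (2 * n + (1 + (1 + 0))) + 0)) (l + n + n - n) h"
    unfolding cholesky_solve_def carrier_matD[OF LC]
    by (intro triple_new_vec_bind triple_release_bind triple_bind[OF forward] triple_bind[OF backward] triple_ret conjI solution)
      (use h in auto)
  from triple_conseq[OF this, of _ "2 * (n * (2 * n + 2))"] show ?thesis
    by (simp add: algebra_simps)
qed

text \<open>The result is pinned down as an exact matrix, since the hypotheses on the spatial solver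
  speak of Schur decompositions of \<open>mat_inv A\<^sub>t * M\<^sub>t\<close>. The columnwise
  equations determine it because \<open>A\<close> is invertible.\<close>

lemma triple_cholesky_solve_cols:
  assumes A: "spd n A" and L: "cholesky_columns n n A L" and R: "R \<in> carrier_mat n c" and h: "l + n * c + 2 * n \<le> h"
  shows "triple (cholesky_solve_cols L R) l (\<lambda>X. X = mat_inv A * R) (c * (2 * (n * (2 * n + 2)))) (l + n * c) h"
proof -
  have pd: "positive_definite n A" using A by (simp add: spd_def)
  have AC: "A \<in> carrier_mat n n" using pd by (simp add: positive_definite_def)
  have LC: "L \<in> carrier_mat n n" using L by (auto simp: cholesky_columns_def)
  let ?I = "\<lambda>k X. X \<in> carrier_mat n c \<and> (\<forall>j<k. A *\<^sub>v col X j = col R j)"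
  have loop: "triple (loop (\<lambda>k X. do {
         x \<leftarrow> cholesky_solve L (col R k);
         release n;
         ret (replace_col X x k)
       }) [0..<c] (0\<^sub>m n c)) (l + n * c) (?I (length [0..<c])) (length [0..<c] * (2 * (n * (2 * n + 2)))) (l + n * c) h"
  proof (rule triple_loop[where I = ?I])
    fix k X assume "k < length [0..<c]" and X: "?I k X"
    then have k: "k < c" "[0..<c] ! k = k" by auto
    have new: "?I (Suc k) (replace_col X x k)" if "x \<in> carrier_vec n \<and> A *\<^sub>v x = col R k" for x
    proof -
      have "col (replace_col X x k) j = (if j = k then x else col X j)" if "j < c" for j
        using X that \<open>x \<in> carrier_vec n \<and> _\<close> by (auto simp: replace_col_def)
      then show ?thesis
        using X k that by (auto simp: less_Suc_eq replace_col_def)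
    qed
    have "triple (do {x \<leftarrow> cholesky_solve L (col R k); release n; ret (replace_col X x k)})
        (l + n * c) (?I (Suc k)) (2 * (n * (2 * n + 2)) + 0) (l + n * c + n - n) h"
      by (intro triple_bind[OF triple_cholesky_solve[OF A L]] triple_release_bind triple_ret new)
        (use R h in auto)
    then show "triple (do {
         x \<leftarrow> cholesky_solve L (col R ([0..<c] ! k));
         release n;
         ret (replace_col X x ([0..<c] ! k))
       }) (l + n * c) (?I (Suc k)) (2 * (n * (2 * n + 2))) (l + n * c) h"
      unfolding k(2) by simp
  qed auto
  have "X = mat_inv A * R" if "?I (length [0..<c]) X" for X
  proof -
    have "A * X = R"
    proof (rule eq_matI)
      fix i j assume "i < dim_row R" "j < dim_col R"
      then have ij: "i < n" "j < c" using R by auto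
      then have "A *\<^sub>v col X j = col R j" using that by auto
      from arg_cong[OF this, of "\<lambda>v. v $ i"] show "(A * X) $$ (i,j) = R $$ (i,j)"
        using ij R AC conjunct1[OF that] by auto
    qed (use AC R that in auto)
    then have "mat_inv A * R = (mat_inv A * A) * X"
      using assoc_mult_mat[OF positive_definite_inverse(3)[OF pd] AC, of X c] that by auto
    then show ?thesis
      using positive_definite_inverse(2)[OF pd] that by auto
  qed
  from triple_conseq[OF loop this order_refl] show ?thesis
    using h unfolding cholesky_solve_cols_def carrier_matD[OF LC] carrier_matD[OF R]
    by (intro triple_new_mat_bind) simp_all
qed

section \<open>Solvability of the spatial systems\<close>

definition sesq_form :: "nat \<Rightarrow> real mat \<Rightarrow> complex vec \<Rightarrow> complex" where
  "sesq_form n A v = (\<Sum>i<n. cnj (v $ i) * (cmat A *\<^sub>v v) $ i)"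

lemma sesq_form_sum:
  assumes "A \<in> carrier_mat n n" "v \<in> carrier_vec n"
  shows "sesq_form n A v = (\<Sum>i<n. \<Sum>k<n. cnj (v $ i) * A $$ (i,k) * v $ k)"
  using assms by (auto simp: sesq_form_def scalar_prod_def sum_distrib_left mult.assoc atLeast0LessThan intro!: sum.cong)

text \<open>Write v = a + i b with real a and b. The cross terms a^T A b and b^T A a enter only the
  imaginary part, so the real part is a^T A a + b^T A b whether or not A is symmetric. This is what
  admits the nonsymmetric \<open>M\<^sub>t\<close>.\<close>

lemma Re_sesq_form_pos:
  assumes A: "positive_definite n A" and v: "v \<in> carrier_vec n" "v \<noteq> 0\<^sub>v n"
  shows "0 < Re (sesq_form n A v)"
proof -
  have AC: "A \<in> carrier_mat n n"
    and pd: "\<And>x. x \<in> carrier_vec n \<Longrightarrow> x \<noteq> 0\<^sub>v n \<Longrightarrow> 0 < x \<bullet> (A *\<^sub>v x)"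
    using A by (auto simp: positive_definite_def)
  have psd: "0 \<le> x \<bullet> (A *\<^sub>v x)" if "x \<in> carrier_vec n" for x
    using pd[OF that] AC by (cases "x = 0\<^sub>v n") (auto simp: less_imp_le)
  let ?a = "map_vec Re v" and ?b = "map_vec Im v"
  have ab: "?a \<in> carrier_vec n" "?b \<in> carrier_vec n" using v by auto
  have "?a \<noteq> 0\<^sub>v n \<or> ?b \<noteq> 0\<^sub>v n"
  proof (rule ccontr)
    assume "\<not> ?thesis"
    then have "Re (v $ i) = 0 \<and> Im (v $ i) = 0" if "i < n" for i
      using that v(1) by (metis carrier_vecD index_map_vec(1) index_zero_vec(1))
    then have "v = 0\<^sub>v n" using v(1) by (intro eq_vecI) (auto simp: complex_eq_iff)
    then show False using v(2) by simp
  qed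
  then have "0 < ?a \<bullet> (A *\<^sub>v ?a) + ?b \<bullet> (A *\<^sub>v ?b)"
    using pd[of ?a] pd[of ?b] psd[OF ab(1)] psd[OF ab(2)] ab by (smt (verit))
  also have "\<dots> = Re (sesq_form n A v)"
    unfolding sesq_form_sum[OF AC v(1)] quadratic_form_sum[OF AC ab(1)] quadratic_form_sum[OF AC ab(2)]
      Re_sum sum.distrib[symmetric]
    using v(1) by (intro sum.cong refl) (auto simp: algebra_simps)
  finally show ?thesis .
qed

text \<open>For v = a + i b the imaginary part is a^T A b - b^T A a, which vanishes by symmetry. It
  is used to take real parts of a product: Re (s q) = Re s Re q when q = v^* A v is real.\<close>

lemma Im_sesq_form_zero:
  assumes A: "A \<in> carrier_mat n n" "transpose_mat A = A" and v: "v \<in> carrier_vec n"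
  shows "Im (sesq_form n A v) = 0"
proof -
  have sym: "A $$ (i,k) = A $$ (k,i)" if "i < n" "k < n" for i k
    using arg_cong[OF A(2), of "\<lambda>A. A $$ (i,k)"] that A(1) by auto
  let ?t = "\<lambda>i k. A $$ (i,k) * (Re (v $ i) * Im (v $ k))"
  have "Im (sesq_form n A v) = (\<Sum>i<n. \<Sum>k<n. ?t i k) - (\<Sum>i<n. \<Sum>k<n. ?t k i)"
    unfolding sesq_form_sum[OF A(1) v] Im_sum sum_subtractf[symmetric]
    by (intro sum.cong refl) (auto simp: algebra_simps sym)
  also have "(\<Sum>i<n. \<Sum>k<n. ?t k i) = (\<Sum>i<n. \<Sum>k<n. ?t i k)"
    by (rule sum.swap)
  finally show ?thesis by simp
qed

lemma cmat_mult: "A \<in> carrier_mat n k \<Longrightarrow> B \<in> carrier_mat k l \<Longrightarrow> cmat (A * B) = cmat A * cmat B"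
  by (rule of_real_hom.mat_hom_mult)

lemma mat_adjoint_eq: "mat_adjoint W = map_mat cnj (transpose_mat W)" for W :: "complex mat"
  by (rule eq_matI) (auto simp: mat_adjoint_def mat_of_rows_def)

text \<open>\<open>B\<close> and \<open>S\<close> are similar through the unitary \<open>W\<close>,
  and the characteristic polynomial of a triangular matrix is the product of the linear factors
  given by its diagonal.\<close>

lemma complex_schur_eigenvalue:
  assumes "complex_schur n B W S" "k < n"
  shows "eigenvalue B (S $$ (k,k))"
proof -
  have W: "W \<in> carrier_mat n n" "W * mat_adjoint W = 1\<^sub>m n" "mat_adjoint W * W = 1\<^sub>m n"
    and S: "S \<in> carrier_mat n n" "upper_triangular S" and B: "B = W * S * mat_adjoint W"
    using assms(1) by (auto simp: complex_schur_def unitary_def)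
  have W': "mat_adjoint W \<in> carrier_mat n n" using W(1) by (auto simp: mat_adjoint_eq)
  have BC: "B \<in> carrier_mat n n" using W(1) W' S(1) B by simp
  have "similar_mat B S"
    unfolding similar_mat_def similar_mat_wit_def using W W' S(1) B BC
    by (intro exI[of _ W] exI[of _ "mat_adjoint W"]) (simp add: Let_def)
  then have "char_poly B = char_poly S" by (rule char_poly_similar)
  moreover have "poly (char_poly S) (S $$ (k,k)) = 0"
    using S assms(2)
    by (auto simp: char_poly_upper_triangular[OF S] poly_prod_list prod_list_zero_iff diag_mat_def)
  ultimately show ?thesis
    unfolding eigenvalue_root_char_poly[OF BC] by simp
qed

lemma uniquely_solvable_if_trivial_kernel:
  assumes B: "B \<in> carrier_mat m m" and b: "b \<in> carrier_vec m"
    and ker: "\<And>z. z \<in> carrier_vec m \<Longrightarrow> B *\<^sub>v z = 0\<^sub>v m \<Longrightarrow> z = 0\<^sub>v m"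
  shows "uniquely_solvable B b"
proof -
  have "det B \<noteq> 0"
    unfolding det_0_iff_vec_prod_zero_field[OF B] using ker by blast
  then obtain C where "C \<in> carrier_mat m m" "B * C = 1\<^sub>m m"
    using det_non_zero_imp_unit[OF B, of "()"] by (auto simp: Units_def ring_mat_def)
  then have "B *\<^sub>v (C *\<^sub>v b) = b" "C *\<^sub>v b \<in> carrier_vec m"
    using B b by (auto simp flip: assoc_mult_mat_vec)
  moreover have "z = z'" if "z \<in> carrier_vec m" "z' \<in> carrier_vec m" "B *\<^sub>v z = b" "B *\<^sub>v z' = b" for z z'
  proof -
    have "B *\<^sub>v (z - z') = 0\<^sub>v m"
      using that B b by (simp add: mult_minus_distrib_mat_vec)
    then have "z - z' = 0\<^sub>v m" using ker[of "z - z'"] that by auto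
    then show ?thesis
      using that by (metis carrier_vecD eq_vecI index_minus_vec(1) index_zero_vec(1) right_minus_eq)
  qed
  ultimately show ?thesis
    using B unfolding uniquely_solvable_def by auto
qed

lemma schur_diagonal_Re_pos:
  assumes A: "spd n A" and M: "positive_definite n M"
    and schur: "complex_schur n (cmat (mat_inv A * M)) W S" and k: "k < n"
  shows "0 < Re (S $$ (k,k))"
proof -
  let ?s = "S $$ (k,k)"
  have pd: "positive_definite n A" and sym: "transpose_mat A = A" using A by (auto simp: spd_def)
  have AC: "A \<in> carrier_mat n n" and MC: "M \<in> carrier_mat n n"
    using pd M by (auto simp: positive_definite_def)
  note inv = positive_definite_inverse[OF pd]
  obtain v where v: "v \<in> carrier_vec n" "v \<noteq> 0\<^sub>v n" "cmat (mat_inv A * M) *\<^sub>v v = ?s \<cdot>\<^sub>v v"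
    using complex_schur_eigenvalue[OF schur k] inv(3) MC by (auto simp: eigenvalue_def eigenvector_def)
  have "A * (mat_inv A * M) = M"
    using inv AC MC by (simp flip: assoc_mult_mat[of _ n n _ n _ n])
  then have "cmat M *\<^sub>v v = cmat A *\<^sub>v (cmat (mat_inv A * M) *\<^sub>v v)"
    using inv AC MC v(1) cmat_mult[of A n n "mat_inv A * M" n]
      assoc_mult_mat_vec[of "cmat A" n n "cmat (mat_inv A * M)" n v] by simp
  then have Mv: "cmat M *\<^sub>v v = ?s \<cdot>\<^sub>v (cmat A *\<^sub>v v)"
    using v AC by (simp add: mult_mat_vec)
  have "sesq_form n M v = ?s * sesq_form n A v"
    using AC unfolding sesq_form_def Mv sum_distrib_left by (intro sum.cong) auto
  then have "Re (sesq_form n M v) = Re ?s * Re (sesq_form n A v)"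
    using Im_sesq_form_zero[OF AC sym v(1)] by simp
  then show ?thesis
    using Re_sesq_form_pos[OF M v(1,2)] Re_sesq_form_pos[OF pd v(1,2)] by (simp add: zero_less_mult_iff)
qed

lemma step3_matrix_carrier:
  "M \<in> carrier_mat m m \<Longrightarrow> A \<in> carrier_mat m m \<Longrightarrow> step3_matrix M A S k \<in> carrier_mat m m"
  by (simp add: step3_matrix_def)

lemma step3_matrix_mult_vec:
  assumes "M \<in> carrier_mat m m" "A \<in> carrier_mat m m" "z \<in> carrier_vec m"
  shows "step3_matrix M A S k *\<^sub>v z = cmat M *\<^sub>v z + S $$ (k,k) \<cdot>\<^sub>v (cmat A *\<^sub>v z)"
  using assms unfolding step3_matrix_def
  by (intro eq_vecI) (auto simp: add_mult_distrib_mat_vec[of _ m m])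

lemma step3_uniquely_solvable:
  assumes M: "spd m M" and A: "spd m A" and pos: "0 < Re (S $$ (k,k))" and b: "b \<in> carrier_vec m"
  shows "uniquely_solvable (step3_matrix M A S k) b"
proof (rule uniquely_solvable_if_trivial_kernel[OF step3_matrix_carrier b])
  show MC: "M \<in> carrier_mat m m" and AC: "A \<in> carrier_mat m m"
    using M A by (auto simp: spd_def positive_definite_def)
  fix z assume z: "z \<in> carrier_vec m" "step3_matrix M A S k *\<^sub>v z = 0\<^sub>v m"
  let ?s = "S $$ (k,k)"
  show "z = 0\<^sub>v m"
  proof (rule ccontr)
    assume nz: "z \<noteq> 0\<^sub>v m"
    have "(cmat M *\<^sub>v z) $ i + ?s * (cmat A *\<^sub>v z) $ i = 0" if "i < m" for i
    proof -
      have "step3_matrix M A S k *\<^sub>v z = cmat M *\<^sub>v z + ?s \<cdot>\<^sub>v (cmat A *\<^sub>v z)"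
        by (rule step3_matrix_mult_vec[OF MC AC z(1)])
      from arg_cong[OF this, of "\<lambda>v. v $ i"] show ?thesis
        using MC AC z that by simp
    qed
    then have "(\<Sum>i<m. cnj (z $ i) * ((cmat M *\<^sub>v z) $ i + ?s * (cmat A *\<^sub>v z) $ i)) = 0"
      by simp
    then have "sesq_form m M z + ?s * sesq_form m A z = 0"
      by (simp add: sesq_form_def sum_distrib_left sum.distrib algebra_simps)
    then have "Re (sesq_form m M z + ?s * sesq_form m A z) = 0" by simp
    then have "Re (sesq_form m M z) + Re ?s * Re (sesq_form m A z) = 0"
      using Im_sesq_form_zero[OF AC _ z(1)] A by (simp add: spd_def)
    then show False
      using Re_sesq_form_pos[OF _ z(1) nz] M A pos
      by (metis add_pos_pos less_irrefl mult_pos_pos spd_def)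
  qed
qed

section \<open>Correctness of the algorithm\<close>

text \<open>Column k of Z S^T combines the columns z_j with coefficients S[k,j], and triangularity
  leaves only j \<ge> k: the term j = k belongs to the step matrix, the terms j > k to the
  right-hand side. One direction serves the output itself, the other subjects an arbitrary solution
  to Step 3.\<close>

lemma step3_iff_matrix_equation:
  assumes M: "M \<in> carrier_mat m m" and A: "A \<in> carrier_mat m m" and S: "S \<in> carrier_mat n n" "upper_triangular S"
    and G: "G \<in> carrier_mat m n" and Z: "Z \<in> carrier_mat m n"
  shows "(\<forall>k<n. step3_matrix M A S k *\<^sub>v col Z k = step3_rhs A S G Z k) \<longleftrightarrow>
    cmat M * Z + cmat A * (Z * transpose_mat S) = G"
proof -
  have AZS: "(cmat A * (Z * transpose_mat S)) $$ (i,k) =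
      S $$ (k,k) * (cmat A *\<^sub>v col Z k) $ i + (\<Sum>j\<in>{k<..<n}. S $$ (k,j) * (cmat A *\<^sub>v col Z j) $ i)"
    if "i < m" "k < n" for i k
  proof -
    define P where "P = cmat A * Z"
    have P: "P \<in> carrier_mat m n" "\<And>j. j < n \<Longrightarrow> P $$ (i,j) = (cmat A *\<^sub>v col Z j) $ i"
      using A Z that by (auto simp: P_def)
    have "cmat A * (Z * transpose_mat S) = P * transpose_mat S"
      using A Z S by (simp add: P_def assoc_mult_mat[of _ m m _ n _ n])
    then have "(cmat A * (Z * transpose_mat S)) $$ (i,k) = (\<Sum>j<n. S $$ (k,j) * P $$ (i,j))"
      using that P(1) S by (simp add: scalar_prod_def mult.commute atLeast0LessThan)
    also have "\<dots> = (\<Sum>j<n. S $$ (k,j) * (cmat A *\<^sub>v col Z j) $ i)"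
      using P(2) by (intro sum.cong) auto
    also have "\<dots> = (\<Sum>j\<in>{k..<n}. S $$ (k,j) * (cmat A *\<^sub>v col Z j) $ i)"
      using S that by (intro sum.mono_neutral_right) (auto simp: upper_triangular_def)
    also have "{k..<n} = insert k {k<..<n}" using that by auto
    finally show ?thesis by simp
  qed
  have "step3_matrix M A S k *\<^sub>v col Z k = step3_rhs A S G Z k \<longleftrightarrow>
      (\<forall>i<m. (cmat M * Z + cmat A * (Z * transpose_mat S)) $$ (i,k) = G $$ (i,k))" if k: "k < n" for k
  proof -
    have "step3_matrix M A S k *\<^sub>v col Z k = cmat M *\<^sub>v col Z k + S $$ (k,k) \<cdot>\<^sub>v (cmat A *\<^sub>v col Z k)"
      by (rule step3_matrix_mult_vec[OF M A]) (use Z k in simp)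
    then have "step3_matrix M A S k *\<^sub>v col Z k = step3_rhs A S G Z k \<longleftrightarrow>
        (\<forall>i<m. (cmat M *\<^sub>v col Z k) $ i + S $$ (k,k) * (cmat A *\<^sub>v col Z k) $ i =
          G $$ (i,k) - (\<Sum>j\<in>{k<..<n}. S $$ (k,j) * (cmat A *\<^sub>v col Z j) $ i))"
      using M A S Z by (auto simp: step3_rhs_def vec_eq_iff)
    also have "\<dots> \<longleftrightarrow> (\<forall>i<m. (cmat M * Z + cmat A * (Z * transpose_mat S)) $$ (i,k) = G $$ (i,k))"
    proof (intro all_cong1 imp_cong refl)
      fix i assume "i < m"
      have "(cmat M * Z + cmat A * (Z * transpose_mat S)) $$ (i,k) =
          (cmat M *\<^sub>v col Z k) $ i + (cmat A * (Z * transpose_mat S)) $$ (i,k)"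
        using \<open>i < m\<close> k M A Z S by simp
      then show "((cmat M *\<^sub>v col Z k) $ i + S $$ (k,k) * (cmat A *\<^sub>v col Z k) $ i =
          G $$ (i,k) - (\<Sum>j\<in>{k<..<n}. S $$ (k,j) * (cmat A *\<^sub>v col Z j) $ i)) \<longleftrightarrow>
        (cmat M * Z + cmat A * (Z * transpose_mat S)) $$ (i,k) = G $$ (i,k)"
        unfolding AZS[OF \<open>i < m\<close> k] by (auto simp: algebra_simps)
    qed
    finally show ?thesis .
  qed
  then show ?thesis
    using M A S Z G by (auto simp: mat_eq_iff)
qed

text \<open>The right-hand side for column \<open>k\<close> involves only columns of larger index,
  so equality propagates from the last column downwards; hence the induction on
  \<open>n - k\<close>.\<close>

lemma step3_unique:
  assumes M: "M \<in> carrier_mat m m" and A: "A \<in> carrier_mat m m" and S: "S \<in> carrier_mat n n"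
    and solvable: "\<And>k b. k < n \<Longrightarrow> b \<in> carrier_vec m \<Longrightarrow> uniquely_solvable (step3_matrix M A S k) b"
    and Z: "Z \<in> carrier_mat m n" "\<And>k. k < n \<Longrightarrow> step3_matrix M A S k *\<^sub>v col Z k = step3_rhs A S G Z k"
    and Z': "Z' \<in> carrier_mat m n" "\<And>k. k < n \<Longrightarrow> step3_matrix M A S k *\<^sub>v col Z' k = step3_rhs A S G Z' k"
  shows "Z = Z'"
proof -
  have "col Z k = col Z' k" if "k < n" for k
    using that
  proof (induction "n - k" arbitrary: k rule: less_induct)
    case less
    have "step3_rhs A S G Z k = step3_rhs A S G Z' k"
      using less S unfolding step3_rhs_def by (intro eq_vecI) (auto intro!: sum.cong)
    moreover have "uniquely_solvable (step3_matrix M A S k) (step3_rhs A S G Z' k)"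
      using solvable[OF less.prems] A by (simp add: step3_rhs_def)
    moreover have "dim_col (step3_matrix M A S k) = m"
      using A M by (simp add: step3_matrix_def)
    ultimately show ?case
      using Z(2)[OF less.prems] Z'(2)[OF less.prems] Z(1) Z'(1) unfolding uniquely_solvable_def
      by (metis col_carrier_vec less.prems carrier_matD(1) col_dim)
  qed
  then show ?thesis
    using Z(1) Z'(1) by (intro mat_col_eqI) auto
qed

text \<open>Right multiplications by conj(W) and by W^T are inverse substitutions between the
  unknowns U and Z. The second claim serves existence, the first and third serve uniqueness.\<close>

lemma matrix_equation_transform:
  fixes W S :: "complex mat"
  assumes At: "spd n A\<^sub>t" and Mt: "M\<^sub>t \<in> carrier_mat n n"
    and schur: "complex_schur n (cmat (mat_inv A\<^sub>t * M\<^sub>t)) W S"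
    and M: "M \<in> carrier_mat m m" and A: "A \<in> carrier_mat m m" and F: "F \<in> carrier_mat m n"
  defines "G \<equiv> cmat (F * mat_inv A\<^sub>t) * map_mat cnj W"
    and "E \<equiv> \<lambda>U. cmat M * (U * cmat A\<^sub>t) + cmat A * (U * transpose_mat (cmat M\<^sub>t))"
  shows "U \<in> carrier_mat m n \<Longrightarrow> E U = cmat F \<Longrightarrow>
      cmat M * (U * map_mat cnj W) + cmat A * (U * map_mat cnj W * transpose_mat S) = G" (is "_ \<Longrightarrow> _ \<Longrightarrow> ?to")
    and "Z \<in> carrier_mat m n \<Longrightarrow> cmat M * Z + cmat A * (Z * transpose_mat S) = G \<Longrightarrow>
      E (Z * transpose_mat W) = cmat F" (is "_ \<Longrightarrow> _ \<Longrightarrow> ?from")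
    and "U \<in> carrier_mat m n \<Longrightarrow> U * map_mat cnj W * transpose_mat W = U" (is "_ \<Longrightarrow> ?inv")
proof -
  have pd: "positive_definite n A\<^sub>t" and sym: "transpose_mat A\<^sub>t = A\<^sub>t" using At by (auto simp: spd_def)
  have AtC: "A\<^sub>t \<in> carrier_mat n n" using pd by (simp add: positive_definite_def)
  note inv = positive_definite_inverse[OF pd]
  have W: "W \<in> carrier_mat n n" "W * mat_adjoint W = 1\<^sub>m n" "mat_adjoint W * W = 1\<^sub>m n"
    and SC: "S \<in> carrier_mat n n" and B: "cmat (mat_inv A\<^sub>t * M\<^sub>t) = W * S * mat_adjoint W"
    using schur by (auto simp: complex_schur_def unitary_def)
  define a where "a = cmat A\<^sub>t"
  define ai where "ai = cmat (mat_inv A\<^sub>t)"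
  define b where "b = transpose_mat (cmat M\<^sub>t)"
  define C where "C = map_mat cnj W"
  define T where "T = transpose_mat W"
  define R where "R = transpose_mat S"
  define X where "X = cmat M"
  define Y where "Y = cmat A"
  define H where "H = cmat F"
  have carrier [simp]: "a \<in> carrier_mat n n" "ai \<in> carrier_mat n n" "b \<in> carrier_mat n n" "C \<in> carrier_mat n n"
    "T \<in> carrier_mat n n" "R \<in> carrier_mat n n" "X \<in> carrier_mat m m" "Y \<in> carrier_mat m m" "H \<in> carrier_mat m n"
    using AtC inv Mt W SC M A F by (auto simp: a_def ai_def b_def C_def T_def R_def X_def Y_def H_def)
  have adj: "mat_adjoint W \<in> carrier_mat n n" "transpose_mat (mat_adjoint W) = C"
    using W(1) by (auto simp: mat_adjoint_eq C_def)
  have aai: "a * ai = 1\<^sub>m n" "ai * a = 1\<^sub>m n"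
    using inv AtC cmat_mult[of A\<^sub>t n n "mat_inv A\<^sub>t" n] cmat_mult[of "mat_inv A\<^sub>t" n n A\<^sub>t n]
    by (simp_all add: a_def ai_def of_real_hom.mat_hom_one)
  have CT: "C * T = 1\<^sub>m n" "T * C = 1\<^sub>m n"
    using arg_cong[OF W(2), of transpose_mat] arg_cong[OF W(3), of transpose_mat] W(1) adj
    by (simp_all add: transpose_mult[of _ n n _ n] T_def)
  have "A\<^sub>t * (mat_inv A\<^sub>t * M\<^sub>t) = M\<^sub>t"
    using inv AtC Mt by (simp flip: assoc_mult_mat[of _ n n _ n _ n])
  then have "cmat M\<^sub>t = a * (W * S * mat_adjoint W)"
    using cmat_mult[of A\<^sub>t n n "mat_inv A\<^sub>t * M\<^sub>t" n] AtC inv Mt B by (simp add: a_def)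
  moreover have "transpose_mat a = a"
    using arg_cong[OF sym, of cmat] by (simp add: a_def map_mat_transpose)
  \<comment> \<open>Transposing reverses the factors and turns W^* into conj(W). Symmetry leaves
    \<open>a\<close> as the last factor, where it cancels against the \<open>ai\<close> in
    \<open>G\<close>.\<close>
  ultimately have b: "b = C * (R * T) * a"
    using W(1) SC adj
    by (simp add: b_def R_def T_def transpose_mult[of _ n n _ n] assoc_mult_mat[of _ n n _ n _ n])
  \<comment> \<open>Products are normalised to the right. The rules \<open>cancel\<close> remove
    inverse pairs that stand before a further factor, while \<open>aai\<close> and \<open>CT\<close>
    handle pairs at the end of a product.\<close>
  note prod_carrier [simp] = mult_carrier_mat[of _ m m _ n] mult_carrier_mat[of _ m n _ n] mult_carrier_mat[of _ n n _ n]
  note assoc [simp] = assoc_mult_mat[of _ m m _ n _ n] assoc_mult_mat[of _ m n _ n _ n] assoc_mult_mat[of _ n n _ n _ n]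
  have cancel [simp]: "a * (ai * V) = V" "ai * (a * V) = V" "C * (T * V) = V" "T * (C * V) = V"
    if "V \<in> carrier_mat n n" for V
    using that by (simp_all add: aai CT flip: assoc_mult_mat[of _ n n _ n _ n])
  note right_unit [simp] = right_mult_one_mat[of _ n n] right_mult_one_mat[of _ m n]
  have G: "G = H * (ai * C)"
    using cmat_mult[OF F inv(3)] assoc[of H ai C] by (simp add: G_def H_def[symmetric] ai_def[symmetric] C_def[symmetric])
  show ?to if U: "U \<in> carrier_mat m n" and eq: "E U = cmat F"
  proof -
    have "G = (X * (U * a) + Y * (U * b)) * (ai * C)"
      using eq by (simp add: G E_def a_def b_def X_def Y_def H_def)
    also have "\<dots> = X * (U * a) * (ai * C) + Y * (U * b) * (ai * C)"
      using U by (intro add_mult_distrib_mat[of _ m n _ _ n]) auto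
    also have "\<dots> = X * (U * C) + Y * (U * (C * R))"
      using U by (simp add: b CT)
    finally show ?thesis
      using U by (simp add: X_def[symmetric] Y_def[symmetric] C_def[symmetric] R_def[symmetric])
  qed
  show ?from if Z: "Z \<in> carrier_mat m n" and eq: "cmat M * Z + cmat A * (Z * transpose_mat S) = G"
  proof -
    have "H = G * (T * a)"
      by (simp add: G aai)
    also have "\<dots> = (X * Z + Y * (Z * R)) * (T * a)"
      using eq by (simp add: X_def Y_def R_def)
    also have "\<dots> = X * Z * (T * a) + Y * (Z * R) * (T * a)"
      using Z by (intro add_mult_distrib_mat[of _ m n _ _ n]) auto
    also have "\<dots> = X * (Z * T * a) + Y * (Z * T * b)"
      using Z by (simp add: b)
    finally show ?thesis
      by (simp add: E_def a_def b_def X_def Y_def H_def T_def)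
  qed
  show ?inv if "U \<in> carrier_mat m n"
    using that by (simp add: C_def[symmetric] T_def[symmetric] CT)
qed

section \<open>Stacked vectors and the Kronecker product\<close>

lemma sum_product_index:
  fixes f :: "nat \<Rightarrow> nat \<Rightarrow> 'b::comm_monoid_add"
  shows "(\<Sum>q<n * m. f (q div m) (q mod m)) = (\<Sum>k<n. \<Sum>i<m. f k i)"
proof -
  have "(\<Sum>q\<in>{k * m..<k * m + m}. f (q div m) (q mod m)) = (\<Sum>i<m. f k i)" for k
    by (rule sum.reindex_bij_witness[where i = "\<lambda>i. k * m + i" and j = "\<lambda>q. q - k * m"])
      (auto simp: le_iff_add)
  then show ?thesis
    by (simp flip: sum.nat_group)
qed

text \<open>The index q = k m + i of the stacked vector splits the sum into a double sum over k and
  i; interchanging the two sums gives the entries of the iterated matrix product.\<close>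

lemma kronecker_mult_stack_cols:
  fixes A B U :: "'b::comm_semiring_0 mat"
  assumes A: "A \<in> carrier_mat n n" and B: "B \<in> carrier_mat m m" and U: "U \<in> carrier_mat m n"
  shows "(A \<otimes>\<^sub>K B) *\<^sub>v stack_cols U = stack_cols (B * (U * transpose_mat A))"
proof (rule eq_vecI)
  fix p assume "p < dim_vec (stack_cols (B * (U * transpose_mat A)))"
  then have p: "p < n * m" using A B U by (simp add: stack_cols_def)
  then have m: "0 < m" by (cases m) auto
  let ?k = "p div m" and ?i = "p mod m"
  have ki: "?k < n" "?i < m" using p m by (auto simp: less_mult_imp_div_less)
  have "((A \<otimes>\<^sub>K B) *\<^sub>v stack_cols U) $ p =
      (\<Sum>q<n * m. A $$ (?k, q div m) * B $$ (?i, q mod m) * U $$ (q mod m, q div m))"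
    using A B U p by (auto simp: kronecker_def stack_cols_def scalar_prod_def atLeast0LessThan intro!: sum.cong)
  also have "\<dots> = (\<Sum>k<n. \<Sum>i<m. A $$ (?k, k) * B $$ (?i, i) * U $$ (i, k))"
    by (rule sum_product_index)
  also have "\<dots> = (\<Sum>i<m. \<Sum>k<n. B $$ (?i, i) * (U $$ (i, k) * A $$ (?k, k)))"
    by (subst sum.swap) (intro sum.cong refl, simp add: mult_ac)
  also have "\<dots> = (B * (U * transpose_mat A)) $$ (?i, ?k)"
    using A B U ki by (simp add: scalar_prod_def atLeast0LessThan sum_distrib_left)
  also have "\<dots> = stack_cols (B * (U * transpose_mat A)) $ p"
    using A B U p by (simp add: stack_cols_def)
  finally show "((A \<otimes>\<^sub>K B) *\<^sub>v stack_cols U) $ p = stack_cols (B * (U * transpose_mat A)) $ p" .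
qed (use A B U in \<open>simp add: kronecker_def stack_cols_def\<close>)

lemma stack_cols_carrier: "U \<in> carrier_mat m n \<Longrightarrow> stack_cols U \<in> carrier_vec (n * m)"
  by (auto simp: stack_cols_def)

lemma stack_cols_inject:
  assumes "U \<in> carrier_mat m n" "V \<in> carrier_mat m n" "stack_cols U = stack_cols V"
  shows "U = V"
proof (rule eq_matI)
  fix i j assume "i < dim_row V" "j < dim_col V"
  then have ij: "i < m" "j < n" using assms by auto
  then have "j * m + i < n * m"
    using mult_le_mono1[of "Suc j" n m] by simp
  with ij show "U $$ (i,j) = V $$ (i,j)"
    using arg_cong[OF assms(3), of "\<lambda>v. v $ (j * m + i)"] assms(1,2) by (simp add: stack_cols_def)
qed (use assms in auto)

lemma stack_cols_surj:
  assumes "v \<in> carrier_vec (n * m)"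
  obtains U where "U \<in> carrier_mat m n" "stack_cols U = v"
proof
  let ?U = "mat m n (\<lambda>(i,j). v $ (j * m + i))"
  show "?U \<in> carrier_mat m n" by simp
  show "stack_cols ?U = v"
  proof (rule eq_vecI)
    fix p assume "p < dim_vec v"
    then have p: "p < n * m" using assms by simp
    then have "0 < m" by (cases m) auto
    with p show "stack_cols ?U $ p = v $ p"
      by (simp add: stack_cols_def less_mult_imp_div_less)
  qed (use assms in \<open>simp add: stack_cols_def\<close>)
qed

lemma stack_cols_map: "stack_cols (map_mat f U) = map_vec f (stack_cols U)"
proof (rule eq_vecI)
  fix p assume "p < dim_vec (map_vec f (stack_cols U))"
  then have p: "p < dim_col U * dim_row U" by (simp add: stack_cols_def)
  then have "0 < dim_row U" by (cases "dim_row U") auto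
  with p show "stack_cols (map_mat f U) $ p = map_vec f (stack_cols U) $ p"
    by (simp add: stack_cols_def less_mult_imp_div_less)
qed (simp add: stack_cols_def)

lemma stack_cols_add:
  assumes "U \<in> carrier_mat m n" "V \<in> carrier_mat m n"
  shows "stack_cols (U + V) = stack_cols U + stack_cols V"
proof (rule eq_vecI)
  fix p assume "p < dim_vec (stack_cols U + stack_cols V)"
  then have p: "p < n * m" using assms by (simp add: stack_cols_def)
  then have "0 < m" by (cases m) auto
  with p show "stack_cols (U + V) $ p = (stack_cols U + stack_cols V) $ p"
    using assms by (simp add: stack_cols_def less_mult_imp_div_less)
qed (use assms in \<open>simp add: stack_cols_def\<close>)

lemma cmat_add: "A \<in> carrier_mat n k \<Longrightarrow> B \<in> carrier_mat n k \<Longrightarrow> cmat (A + B) = cmat A + cmat B"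
  by (rule eq_matI) auto

lemma cnj_mat_add:
  "A \<in> carrier_mat n k \<Longrightarrow> B \<in> carrier_mat n k \<Longrightarrow> map_mat cnj (A + B) = map_mat cnj A + map_mat cnj B"
  by (rule eq_matI) auto

lemma cnj_mat_mult:
  "A \<in> carrier_mat n k \<Longrightarrow> B \<in> carrier_mat k l \<Longrightarrow> map_mat cnj (A * B) = map_mat cnj A * map_mat cnj B"
  by (rule eq_matI) (auto simp: scalar_prod_def)

lemma cnj_cmat: "map_mat cnj (cmat A) = cmat A"
  by (rule eq_matI) auto

theorem bartels_stewart_output_correct:
  assumes At: "spd n A\<^sub>t" and Mt: "positive_definite n M\<^sub>t" and M: "spd m M" and A: "spd m A"
    and F: "F \<in> carrier_mat m n"
    and out: "bartels_stewart_output n m A\<^sub>t M\<^sub>t M A F u"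
  shows "\<exists>x. unique_solution (A\<^sub>t \<otimes>\<^sub>K M + M\<^sub>t \<otimes>\<^sub>K A) (stack_cols F) x \<and> u = map_vec complex_of_real x"
proof -
  obtain W S Z where schur: "complex_schur n (cmat (mat_inv A\<^sub>t * M\<^sub>t)) W S" and Z: "Z \<in> carrier_mat m n"
    and step3: "\<And>k. k < n \<Longrightarrow> step3_matrix M A S k *\<^sub>v col Z k =
       step3_rhs A S (cmat (F * mat_inv A\<^sub>t) * map_mat cnj W) Z k"
    and u: "u = stack_cols (Z * transpose_mat W)"
    using out unfolding bartels_stewart_output_def by blast
  let ?G = "cmat (F * mat_inv A\<^sub>t) * map_mat cnj W"
  have carrier: "A\<^sub>t \<in> carrier_mat n n" "M\<^sub>t \<in> carrier_mat n n" "M \<in> carrier_mat m m" "A \<in> carrier_mat m m"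
    using At Mt M A by (auto simp: spd_def positive_definite_def)
  have sym: "transpose_mat A\<^sub>t = A\<^sub>t" using At by (simp add: spd_def)
  have W: "W \<in> carrier_mat n n" and S: "S \<in> carrier_mat n n" "upper_triangular S"
    using schur by (auto simp: complex_schur_def unitary_def)
  have G: "?G \<in> carrier_mat m n"
    using F W positive_definite_inverse(3)[of n A\<^sub>t] At by (auto simp: spd_def)
  have solvable: "uniquely_solvable (step3_matrix M A S k) b" if "k < n" "b \<in> carrier_vec m" for k b
    by (rule step3_uniquely_solvable[OF M A schur_diagonal_Re_pos[OF At Mt schur that(1)] that(2)])
  define E where "E U = cmat M * (U * cmat A\<^sub>t) + cmat A * (U * transpose_mat (cmat M\<^sub>t))" for U
  note transform = matrix_equation_transform[OF At carrier(2) schur carrier(3,4) F, folded E_def]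
  note iff = step3_iff_matrix_equation[OF carrier(3,4) S G]
  define U where "U = Z * transpose_mat W"
  have UC: "U \<in> carrier_mat m n" using Z W by (simp add: U_def)
  have EU: "E U = cmat F"
    unfolding U_def by (rule transform(2)[OF Z iffD1[OF iff[OF Z]]]) (use step3 in simp)
  \<comment> \<open>Every solution V yields V conj(W), which satisfies Step 3 for the same W and S;
    the recursion has only one solution, and W^T undoes the substitution. V ranges over complex
    matrices so that the conjugate of \<open>U\<close> can be inserted next.\<close>
  have unique: "V = U" if V: "V \<in> carrier_mat m n" "E V = cmat F" for V
  proof -
    have C: "X * map_mat cnj W \<in> carrier_mat m n" if "X \<in> carrier_mat m n" for X
      using that W by simp
    have step3': "step3_matrix M A S k *\<^sub>v col (X * map_mat cnj W) k = step3_rhs A S ?G (X * map_mat cnj W) k"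
      if k: "k < n" and X: "X \<in> carrier_mat m n" "E X = cmat F" for X k
      by (rule iffD2[OF iff[OF C[OF X(1)]] transform(1)[OF X], rule_format, OF k])
    have "V * map_mat cnj W = U * map_mat cnj W"
      by (rule step3_unique[OF carrier(3,4) S(1) solvable C[OF V(1)] step3'[OF _ V] C[OF UC] step3'[OF _ UC EU]])
    then show ?thesis
      using transform(3)[OF V(1)] transform(3)[OF UC] by metis
  qed
  have "map_mat cnj U = U"
  proof (rule unique)
    \<comment> \<open>All coefficients of \<open>E\<close> and the right-hand side are real, so
      conjugation maps solutions to solutions.\<close>
    have "E (map_mat cnj U) = map_mat cnj (E U)"
      using UC carrier
      by (simp add: E_def cnj_mat_mult[of _ m m _ n] cnj_mat_mult[of _ m n _ n] cnj_cmat map_mat_transpose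
          cnj_mat_add[of _ m n] mult_carrier_mat[of _ m m _ n] mult_carrier_mat[of _ m n _ n])
    then show "E (map_mat cnj U) = cmat F" by (simp add: EU cnj_cmat)
  qed (use UC in simp)
  define X where "X = map_mat Re U"
  have XC: "X \<in> carrier_mat m n" using UC by (simp add: X_def)
  have UX: "U = cmat X"
  proof (rule eq_matI)
    fix i j assume "i < dim_row (cmat X)" "j < dim_col (cmat X)"
    then have ij: "i < m" "j < n" using XC by auto
    then have "cnj (U $$ (i,j)) = U $$ (i,j)"
      using arg_cong[OF \<open>map_mat cnj U = U\<close>, of "\<lambda>U. U $$ (i,j)"] UC by simp
    then show "U $$ (i,j) = cmat X $$ (i,j)"
      using ij UC XC by (simp add: X_def complex_eq_iff)
  qed (use UC XC in auto)
  let ?K = "A\<^sub>t \<otimes>\<^sub>K M + M\<^sub>t \<otimes>\<^sub>K A"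
  have K: "A\<^sub>t \<otimes>\<^sub>K M \<in> carrier_mat (n * m) (n * m)" "M\<^sub>t \<otimes>\<^sub>K A \<in> carrier_mat (n * m) (n * m)"
    using carrier by (auto simp: kronecker_def)
  \<comment> \<open>The embedding \<open>cmat\<close> is injective and commutes with all operations
    in \<open>E\<close>, so uniqueness passes from the complex matrix equation to the real Kronecker
    system.\<close>
  have equiv: "?K *\<^sub>v stack_cols Y = stack_cols F \<longleftrightarrow> E (cmat Y) = cmat F" if Y: "Y \<in> carrier_mat m n" for Y
  proof -
    let ?L = "M * (Y * A\<^sub>t) + A * (Y * transpose_mat M\<^sub>t)"
    have L: "?L \<in> carrier_mat m n"
      using Y carrier by (simp add: mult_carrier_mat[of _ m m _ n] mult_carrier_mat[of _ m n _ n])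
    have "?K *\<^sub>v stack_cols Y = stack_cols (M * (Y * A\<^sub>t)) + stack_cols (A * (Y * transpose_mat M\<^sub>t))"
      using add_mult_distrib_mat_vec[OF K stack_cols_carrier[OF Y]] sym
        kronecker_mult_stack_cols[OF carrier(1,3) Y] kronecker_mult_stack_cols[OF carrier(2,4) Y] by simp
    also have "\<dots> = stack_cols ?L"
      using Y carrier by (intro stack_cols_add[symmetric]) auto
    finally have "?K *\<^sub>v stack_cols Y = stack_cols F \<longleftrightarrow> ?L = F"
      using stack_cols_inject[OF L F] by auto
    also have "\<dots> \<longleftrightarrow> cmat ?L = cmat F"
      by (rule iffI[OF arg_cong of_real_hom.mat_hom_inj])
    also have "cmat ?L = E (cmat Y)"
      using Y carrier
      by (simp add: E_def cmat_mult[of _ m m _ n] cmat_mult[of _ m n _ n] map_mat_transpose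
          cmat_add[of _ m n] mult_carrier_mat[of _ m m _ n] mult_carrier_mat[of _ m n _ n])
    finally show ?thesis .
  qed
  have "unique_solution ?K (stack_cols F) (stack_cols X)"
    unfolding unique_solution_def
  proof (intro conjI ballI impI)
    have dim: "dim_col ?K = n * m" using K by simp
    show "stack_cols X \<in> carrier_vec (dim_col ?K)" unfolding dim by (rule stack_cols_carrier[OF XC])
    show "?K *\<^sub>v stack_cols X = stack_cols F" using equiv[OF XC] EU UX by simp
    fix y assume "y \<in> carrier_vec (dim_col ?K)" and y: "?K *\<^sub>v y = stack_cols F"
    then have "y \<in> carrier_vec (n * m)" unfolding dim by simp
    then obtain Y where Y: "Y \<in> carrier_mat m n" "stack_cols Y = y"
      by (rule stack_cols_surj)
    have "cmat Y = cmat X"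
      using unique[of "cmat Y"] iffD1[OF equiv[OF Y(1)]] Y y UX by simp
    then have "Y = X" by (rule of_real_hom.mat_hom_inj)
    then show "y = stack_cols X" using Y by simp
  qed
  moreover have "u = map_vec complex_of_real (stack_cols X)"
    unfolding u U_def[symmetric] UX by (rule stack_cols_map)
  ultimately show ?thesis by (intro exI conjI)
qed

section \<open>Cost of the algorithm\<close>

text \<open>When the result of the first part is determined, the rest of the program need be
  analysed for that one value only, instead of for all values that satisfy a postcondition.\<close>

lemma triple_bind_eq:
  assumes "triple p l (\<lambda>v. v = x) a l' h" "triple (f x) l' R b l'' h"
  shows "triple (p \<bind> f) l R (a + b) l'' h"
  using assms by (auto intro: triple_bind)

lemma nnz_eq_sum: "nnz A = (\<Sum>i<dim_row A. length [j \<leftarrow> [0..<dim_col A]. A $$ (i,j) \<noteq> 0])"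
proof -
  have "{(i,j). i < dim_row A \<and> j < dim_col A \<and> A $$ (i,j) \<noteq> 0} =
      (SIGMA i:{..<dim_row A}. {j. j < dim_col A \<and> A $$ (i,j) \<noteq> 0})"
    by auto
  moreover have "card {j. j < dim_col A \<and> A $$ (i,j) \<noteq> 0} = length [j \<leftarrow> [0..<dim_col A]. A $$ (i,j) \<noteq> 0]" for i
    by (subst distinct_length_filter) (auto intro!: arg_cong[where f = card])
  ultimately show ?thesis
    by (simp add: nnz_def card_SigmaI)
qed

text \<open>The joint pattern is the union of the two nonzero patterns, listed without repetition;
  this keeps assembly and storage of the step matrices linear in the numbers of nonzero entries and
  rows.\<close>

lemma length_joint_pattern:
  assumes "M \<in> carrier_mat m m" "A \<in> carrier_mat m m"
  shows "length (joint_pattern M A) \<le> nnz M + nnz A"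
proof -
  let ?N = "\<lambda>A. {(i,j). i < dim_row A \<and> j < dim_col A \<and> A $$ (i,j) \<noteq> (0::real)}"
  have fin: "finite (?N A)" for A :: "real mat"
    by (rule finite_subset[of _ "{..<dim_row A} \<times> {..<dim_col A}"]) auto
  have "distinct (joint_pattern M A)"
    by (simp add: joint_pattern_def distinct_product)
  then have "length (joint_pattern M A) = card (set (joint_pattern M A))"
    by (simp add: distinct_card)
  also have "\<dots> \<le> card (?N M \<union> ?N A)"
    using assms by (intro card_mono finite_UnI fin) (auto simp: joint_pattern_def)
  also have "\<dots> \<le> nnz M + nnz A"
    unfolding nnz_def by (rule card_Un_le)
  finally show ?thesis .
qed

lemma triple_sparse_mult:
  assumes A: "A \<in> carrier_mat m m" and x: "x \<in> carrier_vec m" and h: "l + m \<le> h"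
  shows "triple (sparse_mult A x) l (\<lambda>y. y = cmat A *\<^sub>v x) (2 * nnz A) (l + m) h"
proof -
  let ?row = "\<lambda>i. [j \<leftarrow> [0..<m]. A $$ (i,j) \<noteq> 0]"
  let ?I = "\<lambda>k y. y = vec m (\<lambda>i. if i < k then (cmat A *\<^sub>v x) $ i else 0)"
  have row: "(\<Sum>j\<leftarrow>?row i. complex_of_real (A $$ (i,j)) * x $ j) = (cmat A *\<^sub>v x) $ i" if "i < m" for i
  proof -
    have "(\<Sum>j\<leftarrow>?row i. complex_of_real (A $$ (i,j)) * x $ j) = (\<Sum>j\<in>set (?row i). complex_of_real (A $$ (i,j)) * x $ j)"
      by (rule sum_list_distinct_conv_sum_set) simp
    also have "\<dots> = (\<Sum>j\<in>{0..<m}. complex_of_real (A $$ (i,j)) * x $ j)"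
      by (rule sum.mono_neutral_left) auto
    finally show ?thesis using that A x by (simp add: scalar_prod_def)
  qed
  have "triple (loop (\<lambda>i y. do {
         s \<leftarrow> dot (?row i) (\<lambda>j. complex_of_real (A $$ (i,j))) (\<lambda>j. x $ j);
         ret (update_vec y i s)
       }) [0..<m] (0\<^sub>v m)) (l + m) (?I (length [0..<m])) (\<Sum>i<length [0..<m]. 2 * length (?row i) + 0) (l + m) h"
  proof (rule triple_loop_sum[where I = ?I])
    fix k y assume "k < length [0..<m]" and y: "?I k y"
    then have k: "k < m" "[0..<m] ! k = k" by auto
    show "triple (do {
         s \<leftarrow> dot (?row ([0..<m] ! k)) (\<lambda>j. complex_of_real (A $$ ([0..<m] ! k,j))) (\<lambda>j. x $ j);
         ret (update_vec y ([0..<m] ! k) s)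
       }) (l + m) (?I (Suc k)) (2 * length (?row k) + 0) (l + m) h"
      unfolding k(2)
      by (intro triple_bind_eq[OF triple_dot] triple_ret)
        (use y k row[OF k(1)] in \<open>auto simp: update_vec_def less_Suc_eq\<close>)
  qed auto
  moreover have "(\<Sum>i<length [0..<m]. 2 * length (?row i) + 0) = 2 * nnz A"
    using A by (simp add: nnz_eq_sum sum_distrib_left)
  moreover have "vec m (\<lambda>i. if i < length [0..<m] then (cmat A *\<^sub>v x) $ i else 0) = cmat A *\<^sub>v x"
    using A by (intro eq_vecI) auto
  ultimately show ?thesis
    using h unfolding sparse_mult_def carrier_matD[OF A] by (intro triple_new_vec_bind) simp_all
qed

text \<open>Outside the joint pattern both summands vanish, so the initial zero is already the right
  value there and visiting the pattern alone yields the whole matrix.\<close>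

lemma triple_assemble_shifted:
  assumes M: "M \<in> carrier_mat m m" and A: "A \<in> carrier_mat m m"
    and h: "l + csr_size m (length (joint_pattern M A)) \<le> h"
  shows "triple (assemble_shifted M A (S $$ (k,k))) l (\<lambda>B. B = step3_matrix M A S k)
    (2 * length (joint_pattern M A)) (l + csr_size m (length (joint_pattern M A))) h"
proof -
  let ?P = "joint_pattern M A"
  let ?e = "\<lambda>ij. complex_of_real (M $$ ij) + S $$ (k,k) * complex_of_real (A $$ ij)"
  let ?I = "\<lambda>n C. C = mat m m (\<lambda>ij. if ij \<in> set (take n ?P) then ?e ij else 0)"
  have loop: "triple (loop (\<lambda>(i,j) C. do {
         p \<leftarrow> mul_op (S $$ (k,k)) (complex_of_real (A $$ (i,j)));
         c \<leftarrow> add_op (complex_of_real (M $$ (i,j))) p;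
         ret (update_mat C (i,j) c)
       }) ?P (0\<^sub>m m m)) (l + csr_size m (length ?P)) (?I (length ?P)) (length ?P * (1 + (1 + 0)))
       (l + csr_size m (length ?P)) h"
  proof (rule triple_loop[where I = ?I])
    fix n C assume n: "n < length ?P" and C: "?I n C"
    obtain i j where ij: "?P ! n = (i,j)" by (cases "?P ! n")
    have "update_mat C (i,j) (?e (i,j)) = mat m m (\<lambda>ij. if ij \<in> set (take (Suc n) ?P) then ?e ij else 0)"
      unfolding take_Suc_conv_app_nth[OF n] ij using C by (intro eq_matI) (auto simp: update_mat_def)
    then show "triple ((case ?P ! n of (i,j) \<Rightarrow> \<lambda>C. do {
         p \<leftarrow> mul_op (S $$ (k,k)) (complex_of_real (A $$ (i,j)));
         c \<leftarrow> add_op (complex_of_real (M $$ (i,j))) p;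
         ret (update_mat C (i,j) c)
       }) C) (l + csr_size m (length ?P)) (?I (Suc n)) (1 + (1 + 0)) (l + csr_size m (length ?P)) h"
      unfolding ij prod.case by (intro triple_mul_bind triple_add_bind triple_ret)
  qed auto
  have matrix: "mat m m (\<lambda>ij. if ij \<in> set (take (length ?P) ?P) then ?e ij else 0) = step3_matrix M A S k"
    using M A by (intro eq_matI) (auto simp: step3_matrix_def joint_pattern_def)
  have cost: "length ?P * (1 + (1 + 0)) = 2 * length ?P" by simp
  show ?thesis
    unfolding assemble_shifted_def carrier_matD[OF M]
    by (intro triple_alloc_bind h loop[unfolded matrix cost])
qed

text \<open>The product of \<open>A\<close> with column \<open>j\<close> is recomputed for every
  \<open>k < j\<close>. Over all of Step 3 this makes fewer than n^2 sparse products and vector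
  updates, which stays within m N^2 by sparsity.\<close>

lemma triple_step3_rhs:
  assumes A: "A \<in> carrier_mat m m" and S: "S \<in> carrier_mat n n" and G: "G \<in> carrier_mat m n"
    and Z: "Z \<in> carrier_mat m n" and k: "k < n" and h: "l + m \<le> h"
  shows "triple (loop (\<lambda>j r. do {
             y \<leftarrow> sparse_mult A (col Z j);
             r \<leftarrow> loop (\<lambda>i r. do {
                 p \<leftarrow> mul_op (S $$ (k,j)) (y $ i);
                 a \<leftarrow> sub_op (r $ i) p;
                 ret (update_vec r i a)
               }) [0..<m] r;
             release m;
             ret r
           }) [Suc k..<n] (col G k)) l (\<lambda>r. r = step3_rhs A S G Z k) (n * (2 * nnz A + 2 * m)) l h"
proof -
  have inner: "triple (loop (\<lambda>i r. do {
                 p \<leftarrow> mul_op s (y $ i);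
                 a \<leftarrow> sub_op (r $ i) p;
                 ret (update_vec r i a)
               }) [0..<m] r) l (\<lambda>r'. r' = r - s \<cdot>\<^sub>v y) (2 * m) l h"
    if r: "r \<in> carrier_vec m" and y: "y \<in> carrier_vec m" for s r y l
  proof -
    let ?I = "\<lambda>c r'. r' = vec m (\<lambda>i. if i < c then r $ i - s * y $ i else r $ i)"
    have "triple (loop (\<lambda>i r. do {
                 p \<leftarrow> mul_op s (y $ i);
                 a \<leftarrow> sub_op (r $ i) p;
                 ret (update_vec r i a)
               }) [0..<m] r) l (?I (length [0..<m])) (length [0..<m] * (1 + (1 + 0))) l h"
    proof (rule triple_loop[where I = ?I])
      fix c r' assume "c < length [0..<m]" and r': "?I c r'"
      then have c: "c < m" "[0..<m] ! c = c" by auto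
      show "triple (do {
                 p \<leftarrow> mul_op s (y $ ([0..<m] ! c));
                 a \<leftarrow> sub_op (r' $ ([0..<m] ! c)) p;
                 ret (update_vec r' ([0..<m] ! c) a)
               }) l (?I (Suc c)) (1 + (1 + 0)) l h"
        unfolding c(2) by (intro triple_mul_bind triple_sub_bind triple_ret)
          (use r' c in \<open>auto simp: update_vec_def less_Suc_eq\<close>)
    qed (use r in auto)
    moreover have "vec m (\<lambda>i. if i < length [0..<m] then r $ i - s * y $ i else r $ i) = r - s \<cdot>\<^sub>v y"
      using r y by (intro eq_vecI) auto
    moreover have "length [0..<m] * (1 + (1 + 0)) = 2 * m" by simp
    ultimately show ?thesis by (simp only:)
  qed
  let ?I = "\<lambda>c r. r = vec m (\<lambda>i. G $$ (i,k) - (\<Sum>j\<in>{k<..<Suc k + c}. S $$ (k,j) * (cmat A *\<^sub>v col Z j) $ i))"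
  have "triple (loop (\<lambda>j r. do {
             y \<leftarrow> sparse_mult A (col Z j);
             r \<leftarrow> loop (\<lambda>i r. do {
                 p \<leftarrow> mul_op (S $$ (k,j)) (y $ i);
                 a \<leftarrow> sub_op (r $ i) p;
                 ret (update_vec r i a)
               }) [0..<m] r;
             release m;
             ret r
           }) [Suc k..<n] (col G k)) l (?I (length [Suc k..<n])) (length [Suc k..<n] * (2 * nnz A + (2 * m + 0))) l h"
  proof (rule triple_loop[where I = ?I])
    fix c r assume "c < length [Suc k..<n]" and r: "?I c r"
    then have j: "Suc k + c < n" "[Suc k..<n] ! c = Suc k + c" by auto
    let ?j = "Suc k + c"
    have rC: "r \<in> carrier_vec m" using r by simp
    have zC: "col Z ?j \<in> carrier_vec m" using Z j(1) by simp
    have yC: "cmat A *\<^sub>v col Z ?j \<in> carrier_vec m" using A zC by simp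
    have "{k<..<Suc k + Suc c} = insert ?j {k<..<Suc k + c}" by auto
    then have new: "?I (Suc c) (r - S $$ (k,?j) \<cdot>\<^sub>v (cmat A *\<^sub>v col Z ?j))"
      using r A by (intro eq_vecI) auto
    have "triple (do {
             y \<leftarrow> sparse_mult A (col Z ?j);
             r \<leftarrow> loop (\<lambda>i r. do {
                 p \<leftarrow> mul_op (S $$ (k,?j)) (y $ i);
                 a \<leftarrow> sub_op (r $ i) p;
                 ret (update_vec r i a)
               }) [0..<m] r;
             release m;
             ret r
           }) l (?I (Suc c)) (2 * nnz A + (2 * m + 0)) (l + m - m) h"
      by (intro triple_bind_eq[OF triple_sparse_mult[OF A zC h]] triple_bind_eq[OF inner[OF rC yC]]
          triple_release_bind triple_ret new)
    then show "triple (do {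
             y \<leftarrow> sparse_mult A (col Z ([Suc k..<n] ! c));
             r \<leftarrow> loop (\<lambda>i r. do {
                 p \<leftarrow> mul_op (S $$ (k,[Suc k..<n] ! c)) (y $ i);
                 a \<leftarrow> sub_op (r $ i) p;
                 ret (update_vec r i a)
               }) [0..<m] r;
             release m;
             ret r
           }) l (?I (Suc c)) (2 * nnz A + (2 * m + 0)) l h"
      unfolding j(2) by simp
  next
    have "{k<..<Suc k} = {}" by auto
    then show "?I 0 (col G k)" using G k by (intro eq_vecI) auto
  qed
  moreover have "?I (length [Suc k..<n]) r \<Longrightarrow> r = step3_rhs A S G Z k" for r
    using A S k by (simp add: step3_rhs_def del: index_mult_mat_vec)
  moreover have "length [Suc k..<n] * (2 * nnz A + (2 * m + 0)) \<le> n * (2 * nnz A + 2 * m)"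
    by (intro mult_le_mono) auto
  ultimately show ?thesis by (rule triple_conseq)
qed

lemma step3_rhs_cong:
  assumes "\<And>j. k < j \<Longrightarrow> j < dim_col S \<Longrightarrow> col Z j = col Z' j"
  shows "step3_rhs A S G Z k = step3_rhs A S G Z' k"
  unfolding step3_rhs_def using assms by (intro eq_vecI) (auto intro!: sum.cong)

text \<open>The \<open>2 * m\<close> in the storage condition stands for the right-hand side and one
  further vector: at first the product of \<open>A\<close> with a column of \<open>Z\<close>, later
  the solution returned by the solver.\<close>

lemma triple_step3:
  assumes M: "M \<in> carrier_mat m m" and A: "A \<in> carrier_mat m m" and S: "S \<in> carrier_mat n n"
    and G: "G \<in> carrier_mat m n"
    and solver: "\<And>k b. k < n \<Longrightarrow> b \<in> carrier_vec m \<Longrightarrow> solves solver (step3_matrix M A S k) b \<and>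
      routine_ops solver (step3_matrix M A S k, b) \<le> oc \<and> routine_mem solver (step3_matrix M A S k, b) \<le> mc"
    and h: "l + 2 * m + csr_size m (length (joint_pattern M A)) + mc \<le> h"
  shows "triple (loop (\<lambda>k Z. do {
         alloc m;
         r \<leftarrow> loop (\<lambda>j r. do {
             y \<leftarrow> sparse_mult A (col Z j);
             r \<leftarrow> loop (\<lambda>i r. do {
                 p \<leftarrow> mul_op (S $$ (k,j)) (y $ i);
                 a \<leftarrow> sub_op (r $ i) p;
                 ret (update_vec r i a)
               }) [0..<m] r;
             release m;
             ret r
           }) [Suc k..<n] (col G k);
         B \<leftarrow> assemble_shifted M A (S $$ (k,k));
         z \<leftarrow> call solver (B, r) m;
         release (csr_size m (length (joint_pattern M A)));
         release m;
         release m;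
         ret (replace_col Z z k)
       }) (rev [0..<n]) (0\<^sub>m m n)) l
     (\<lambda>Z. Z \<in> carrier_mat m n \<and> (\<forall>k<n. step3_matrix M A S k *\<^sub>v col Z k = step3_rhs A S G Z k))
     (n * (n * (2 * nnz A + 2 * m) + 2 * length (joint_pattern M A) + oc)) l h"
proof -
  let ?J = "length (joint_pattern M A)"
  let ?body = "\<lambda>k Z. do {
         alloc m;
         r \<leftarrow> loop (\<lambda>j r. do {
             y \<leftarrow> sparse_mult A (col Z j);
             r \<leftarrow> loop (\<lambda>i r. do {
                 p \<leftarrow> mul_op (S $$ (k,j)) (y $ i);
                 a \<leftarrow> sub_op (r $ i) p;
                 ret (update_vec r i a)
               }) [0..<m] r;
             release m;
             ret r
           }) [Suc k..<n] (col G k);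
         B \<leftarrow> assemble_shifted M A (S $$ (k,k));
         z \<leftarrow> call solver (B, r) m;
         release (csr_size m (length (joint_pattern M A)));
         release m;
         release m;
         ret (replace_col Z z k)
       }"
  let ?I = "\<lambda>c Z. Z \<in> carrier_mat m n \<and>
    (\<forall>k<n. n \<le> k + c \<longrightarrow> step3_matrix M A S k *\<^sub>v col Z k = step3_rhs A S G Z k)"
  have "triple (loop ?body (rev [0..<n]) (0\<^sub>m m n)) l (?I (length (rev [0..<n])))
      (length (rev [0..<n]) * (n * (2 * nnz A + 2 * m) + 2 * ?J + oc)) l h"
  proof (rule triple_loop[where I = ?I])
    fix c Z assume "c < length (rev [0..<n])" and Z: "?I c Z"
    then have "c < n" by simp
    then obtain k where k: "k < n" "n = Suc (k + c)" "rev [0..<n] ! c = k"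
      using that[of "n - Suc c"] by (simp add: rev_nth)
    let ?r = "step3_rhs A S G Z k"
    let ?z = "result solver (step3_matrix M A S k, ?r)"
    have r: "?r \<in> carrier_vec m" using A by (auto simp: step3_rhs_def)
    have z: "?z \<in> carrier_vec m" "step3_matrix M A S k *\<^sub>v ?z = ?r"
      using solver[OF k(1) r] M A by (auto simp: solves_def step3_matrix_def)
    have ZC: "Z \<in> carrier_mat m n" using Z by simp
    have col: "col (replace_col Z ?z k) j = (if j = k then ?z else col Z j)" if "j < n" for j
      using ZC z(1) that by (auto simp: replace_col_def)
    \<comment> \<open>Right-hand sides of index \<open>k\<close> and larger read only columns beyond
      \<open>k\<close>. Storing column \<open>k\<close> therefore preserves the equations already
      solved and leaves its own right-hand side unchanged.\<close>
    have rhs: "step3_rhs A S G (replace_col Z ?z k) j = step3_rhs A S G Z j" if "k \<le> j" for j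
      using S that by (intro step3_rhs_cong) (simp add: col)
    have new: "?I (Suc c) (replace_col Z ?z k)"
    proof (intro conjI allI impI)
      show "replace_col Z ?z k \<in> carrier_mat m n" using ZC by (simp add: replace_col_def)
      fix j assume j: "j < n" "n \<le> j + Suc c"
      then have "k \<le> j" using k by simp
      show "step3_matrix M A S j *\<^sub>v col (replace_col Z ?z k) j = step3_rhs A S G (replace_col Z ?z k) j"
        unfolding col[OF j(1)] rhs[OF \<open>k \<le> j\<close>] using z(2) Z j k by (cases "j = k") auto
    qed
    have call: "triple (call solver (step3_matrix M A S k, ?r) m) l' (\<lambda>z. z = ?z) oc (l' + m) h"
      if "l' + mc \<le> h" "l' + m \<le> h" for l'
      by (rule triple_call) (use solver[OF k(1) r] that in auto)
    have "triple (?body k Z) l (?I (Suc c)) (n * (2 * nnz A + 2 * m) + (2 * ?J + (oc + 0)))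
        (l + m + csr_size m ?J + m - csr_size m ?J - m - m) h"
      by (intro triple_alloc_bind triple_bind_eq[OF triple_step3_rhs[OF A S G ZC k(1)]]
          triple_bind_eq[OF triple_assemble_shifted[OF M A]] triple_bind_eq[OF call]
          triple_release_bind triple_ret new) (use h in linarith)+
    then show "triple (?body (rev [0..<n] ! c) Z) l (?I (Suc c)) (n * (2 * nnz A + 2 * m) + 2 * ?J + oc) l h"
      unfolding k(3) by (simp add: add.assoc)
  qed auto
  then show ?thesis by simp
qed

text \<open>Transposing A \<open>mat_inv A\<close> = 1 shows that the transposed inverse is a left
  inverse of A, hence equal to the right inverse.\<close>

lemma positive_definite_inverse_symmetric:
  assumes "spd n A"
  shows "transpose_mat (mat_inv A) = mat_inv A"
proof -
  have pd: "positive_definite n A" and sym: "transpose_mat A = A" using assms by (auto simp: spd_def)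
  have A: "A \<in> carrier_mat n n" using pd by (simp add: positive_definite_def)
  note inv = positive_definite_inverse[OF pd]
  have "transpose_mat (mat_inv A) * A = 1\<^sub>m n"
    using arg_cong[OF inv(1), of transpose_mat] transpose_mult[OF A inv(3)] sym by simp
  then have "mat_inv A = (transpose_mat (mat_inv A) * A) * mat_inv A"
    using inv(3) by simp
  also have "\<dots> = transpose_mat (mat_inv A) * (A * mat_inv A)"
    using inv(3) A by (simp add: assoc_mult_mat[of _ n n _ n _ n])
  also have "\<dots> = transpose_mat (mat_inv A)"
    using inv(1,3) right_mult_one_mat[of "transpose_mat (mat_inv A)" n n] by simp
  finally show ?thesis by simp
qed

text \<open>The summands of the count follow the phases of the program. At no time are there more
  than four n by n arrays (L, W, S and either the temporal product or conj(W)) or more than three m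
  by n arrays; \<open>2 * n\<close> is for the triangular solves, and the remaining terms are for
  Step 3 and the two routines.\<close>

lemma triple_bartels_stewart:
  assumes At: "spd n A\<^sub>t" and Mt: "positive_definite n M\<^sub>t" and M: "spd m M" and A: "spd m A"
    and F: "F \<in> carrier_mat m n"
    and schur: "complex_schur n (cmat (mat_inv A\<^sub>t * M\<^sub>t)) W S" "result schur (cmat (mat_inv A\<^sub>t * M\<^sub>t)) = (W, S)"
      "routine_ops schur (cmat (mat_inv A\<^sub>t * M\<^sub>t)) \<le> os" "routine_mem schur (cmat (mat_inv A\<^sub>t * M\<^sub>t)) \<le> ms"
    and solver: "\<And>k b. k < n \<Longrightarrow> b \<in> carrier_vec m \<Longrightarrow> solves solver (step3_matrix M A S k) b \<and>
      routine_ops solver (step3_matrix M A S k, b) \<le> oc \<and> routine_mem solver (step3_matrix M A S k, b) \<le> mc"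
    and h: "l + 4 * (n * n) + 3 * (m * n) + 2 * n + 2 * m + csr_size m (length (joint_pattern M A)) + ms + mc \<le> h"
  shows "triple (bartels_stewart schur solver A\<^sub>t M\<^sub>t M A F) l
    (bartels_stewart_output n m A\<^sub>t M\<^sub>t M A F)
    (n * (2 * n + 2 + n * (2 * n + 2)) + (n * (2 * (n * (2 * n + 2))) + (os + (m * (2 * (n * (2 * n + 2))) +
     (n * n + (m * (n * (2 * n)) + (n * (n * (2 * nnz A + 2 * m) + 2 * length (joint_pattern M A) + oc) +
     (m * (n * (2 * n)) + 0))))))))
    (l + 3 * (n * n) + 3 * (m * n)) h"
proof -
  have MtC: "M\<^sub>t \<in> carrier_mat n n" and MC: "M \<in> carrier_mat m m" and AC: "A \<in> carrier_mat m m"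
    and AtC: "A\<^sub>t \<in> carrier_mat n n"
    using At Mt M A by (auto simp: positive_definite_def spd_def)
  have inv: "mat_inv A\<^sub>t \<in> carrier_mat n n"
    using At positive_definite_inverse(3) by (simp add: spd_def)
  have W: "W \<in> carrier_mat n n" and S: "S \<in> carrier_mat n n"
    using schur(1) by (auto simp: complex_schur_def unitary_def)
  have FT: "transpose_mat F \<in> carrier_mat n m" using F by simp
  let ?X = "mat_inv A\<^sub>t * transpose_mat F"
  let ?V = "map_mat cnj W"
  let ?G = "cmat (F * mat_inv A\<^sub>t) * ?V"
  have "transpose_mat ?X = F * mat_inv A\<^sub>t"
    using transpose_mult[OF inv FT] positive_definite_inverse_symmetric[OF At] by simp
  then have G: "transpose_mat (cmat ?X) * ?V = ?G" by (simp add: map_mat_transpose)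
  have XC: "transpose_mat (cmat ?X) \<in> carrier_mat m n" using inv F by simp
  have VC: "?V \<in> carrier_mat n n" and WT: "transpose_mat W \<in> carrier_mat n n" using W by auto
  have GC: "transpose_mat (cmat ?X) * ?V \<in> carrier_mat m n" using XC VC by simp
  have out: "bartels_stewart_output n m A\<^sub>t M\<^sub>t M A F (stack_cols (Z * transpose_mat W))"
    if "Z \<in> carrier_mat m n \<and>
      (\<forall>k<n. step3_matrix M A S k *\<^sub>v col Z k = step3_rhs A S (transpose_mat (cmat ?X) * ?V) Z k)" for Z
    unfolding bartels_stewart_output_def using that schur(1) unfolding G by blast
  have call: "triple (call schur (cmat (mat_inv A\<^sub>t * M\<^sub>t)) (2 * (n * n))) l' (\<lambda>v. v = (W, S)) os (l' + 2 * (n * n)) h"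
    if "l' + ms \<le> h" "l' + 2 * (n * n) \<le> h" for l'
    by (rule triple_call) (use schur that in auto)
  let ?J = "csr_size m (length (joint_pattern M A))"
  \<comment> \<open>The chain lists in program order: L, the temporal product B, the pair W and S,
    the release of B, then X, V, G, the releases of V and X, and finally Z and U. What remains is L,
    W, S and G, Z, U.\<close>
  have live: "l + n * n + n * n + 2 * (n * n) - n * n + n * m + n * n + m * n - n * n - n * m + m * n + m * n =
      l + 3 * (n * n) + 3 * (m * n)"
    by (simp add: mult.commute)
  show ?thesis
    unfolding bartels_stewart_def Let_def carrier_matD[OF AtC] carrier_matD[OF MC] live[symmetric]
    apply (rule triple_bind[OF triple_cholesky[OF At]])
    subgoal using h by linarith
    subgoal premises L for L
      apply (rule triple_bind_eq[OF triple_cholesky_solve_cols[OF At L MtC]])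
      subgoal using h by linarith
      apply (rule triple_bind_eq[OF call])
      subgoal using h by linarith
      subgoal using h by linarith
      unfolding prod.case
      apply (rule triple_release_bind)
      apply (rule triple_bind_eq[OF triple_cholesky_solve_cols[OF At L FT]])
      subgoal using h by (simp add: mult.commute[of n m])
      apply (rule triple_bind_eq[OF triple_mat_cnj[OF W]])
      subgoal using h by (simp add: mult.commute[of n m])
      apply (rule triple_bind_eq[OF triple_mat_mult[OF XC VC]])
      subgoal using h by (simp add: mult.commute[of n m])
      apply (rule triple_release_bind)+
      apply (rule triple_new_mat_bind)
      subgoal using h by (simp add: mult.commute[of n m])
      apply (rule triple_bind[OF triple_step3[OF MC AC S GC solver]])
      subgoal by assumption
      subgoal by assumption
      subgoal using h by (simp add: mult.commute[of n m])
      subgoal premises Z for Z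
        apply (rule triple_bind_eq[OF triple_mat_mult[OF conjunct1[OF Z] WT]])
        subgoal using h by (simp add: mult.commute[of n m])
        by (rule triple_ret) (rule out[OF Z])
      done
    done
qed

section \<open>From explicit counts to asymptotic bounds\<close>

lemma operation_count_bound:
  fixes x y o\<^sub>s o\<^sub>c q J :: real
  assumes "1 \<le> x" "0 \<le> y" "0 \<le> \<alpha>" "0 \<le> \<beta>" "0 \<le> \<gamma>" "0 \<le> c"
    and "o\<^sub>s \<le> \<alpha> * x ^ 3" "q \<le> \<beta> * y" "J \<le> 2 * (\<beta> * y)" "o\<^sub>c \<le> \<gamma> * c"
  shows "x * (2 * x + 2 + x * (2 * x + 2)) + (x * (2 * (x * (2 * x + 2))) + (o\<^sub>s + (y * (2 * (x * (2 * x + 2))) +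
     (x * x + (y * (x * (2 * x)) + (x * (x * (2 * q + 2 * y) + 2 * J + o\<^sub>c) + (y * (x * (2 * x)) + 0)))))))
    \<le> (31 + \<alpha> + 8 * \<beta> + \<gamma>) * (x ^ 3 + y * x ^ 2 + c * x)" (is "?L \<le> _ * ?X")
proof -
  have x: "x \<le> x ^ 2" "x ^ 2 \<le> x ^ 3"
    using assms(1) by (auto simp: power2_eq_square power3_eq_cube)
  then have xy: "x * y \<le> x ^ 2 * y" using assms(2) by (intro mult_right_mono)
  have nonneg: "0 \<le> x ^ 3" "0 \<le> y * x ^ 2" "0 \<le> c * x" using assms by auto
  define X where "X = ?X"
  from nonneg have X: "x ^ 3 \<le> X" "y * x ^ 2 \<le> X" "c * x \<le> X" and "0 \<le> X"
    using assms by (auto simp: X_def)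
  have "x ^ 2 * q \<le> x ^ 2 * (\<beta> * y)" "x * J \<le> x * (2 * (\<beta> * y))" "x * o\<^sub>c \<le> x * (\<gamma> * c)"
    "\<beta> * (x * y) \<le> \<beta> * (x ^ 2 * y)"
    using assms xy by (auto intro!: mult_left_mono)
  \<comment> \<open>The coefficients of x^3, x^2 and x are 6, 9 and 2, those of y x^2 and y x are 10
    and 4; \<open>1 \<le> x\<close> lifts all of them to the highest power, giving 17 and 14. Of the
    6 \<beta>, 2 come from the sparse products and 4 from the assembly.\<close>
  then have "?L \<le> 17 * x ^ 3 + \<alpha> * x ^ 3 + 14 * (y * x ^ 2) + 6 * (\<beta> * (y * x ^ 2)) + \<gamma> * (c * x)"
    using x xy assms(7) by (simp add: algebra_simps power2_eq_square power3_eq_cube)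
  moreover have "\<alpha> * x ^ 3 \<le> \<alpha> * X" "\<beta> * (y * x ^ 2) \<le> \<beta> * X" "\<gamma> * (c * x) \<le> \<gamma> * X"
    using assms X by (auto intro!: mult_left_mono)
  moreover have "0 \<le> \<beta> * X" using assms \<open>0 \<le> X\<close> by auto
  moreover have "(31 + \<alpha> + 8 * \<beta> + \<gamma>) * X = 31 * X + \<alpha> * X + 8 * (\<beta> * X) + \<gamma> * X"
    by (simp add: algebra_simps)
  ultimately show ?thesis using X nonneg \<open>0 \<le> X\<close> unfolding X_def[symmetric] by linarith
qed

lemma storage_bound:
  fixes x y m\<^sub>s m\<^sub>c p q J :: real
  assumes "1 \<le> x" "0 \<le> y" "0 \<le> \<alpha>" "0 \<le> \<beta>" "0 \<le> \<gamma>" "0 \<le> c"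
    and "m\<^sub>s \<le> \<alpha> * x ^ 2" "p \<le> \<beta> * y" "q \<le> \<beta> * y" "J \<le> 2 * (\<beta> * y)" "m\<^sub>c \<le> \<gamma> * c"
  shows "2 * (x * x) + (2 * p + y + 1) + (2 * q + y + 1) + y * x + 4 * (x * x) + 3 * (y * x) + 2 * x + 2 * y +
      (2 * J + y + 1) + m\<^sub>s + m\<^sub>c \<le> (31 + \<alpha> + 8 * \<beta> + \<gamma>) * (x ^ 2 + y * x + c)" (is "?L \<le> _ * ?X")
proof -
  have x: "x \<le> x ^ 2" "1 \<le> x ^ 2" "y \<le> y * x"
    using assms(1,2) mult_left_mono[of 1 x y] by (auto simp: power2_eq_square intro: order_trans[OF assms(1)])
  have nonneg: "0 \<le> x ^ 2" "0 \<le> y * x" using assms by auto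
  define X where "X = ?X"
  from nonneg have X: "x ^ 2 \<le> X" "y * x \<le> X" "c \<le> X" and "0 \<le> X"
    using assms by (auto simp: X_def)
  have "\<beta> * y \<le> \<beta> * (y * x)"
    using assms x by (auto intro!: mult_left_mono)
  \<comment> \<open>Here 11 = 6 + 2 + 3 collects x^2, x and the constants of the three sparse
    matrices, 9 = 4 + 5 collects y x and y, and 8 \<beta> comes from \<open>p\<close>,
    \<open>q\<close> and \<open>J\<close> with shares 2, 2 and 4.\<close>
  then have "?L \<le> 11 * x ^ 2 + \<alpha> * x ^ 2 + 9 * (y * x) + 8 * (\<beta> * (y * x)) + \<gamma> * c"
    unfolding power2_eq_square[symmetric] using x assms by linarith
  moreover have "\<alpha> * x ^ 2 \<le> \<alpha> * X" "\<beta> * (y * x) \<le> \<beta> * X" "\<gamma> * c \<le> \<gamma> * X"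
    using assms X by (auto intro!: mult_left_mono)
  moreover have "0 \<le> \<beta> * X" using assms \<open>0 \<le> X\<close> by auto
  moreover have "(31 + \<alpha> + 8 * \<beta> + \<gamma>) * X = 31 * X + \<alpha> * X + 8 * (\<beta> * X) + \<gamma> * X"
    by (simp add: algebra_simps)
  ultimately show ?thesis using X nonneg \<open>0 \<le> X\<close> unfolding X_def[symmetric] by linarith
qed

lemma run_from_triple:
  assumes "triple p s Q a l' h" "run_from s p = (v, r)" "s \<le> h"
  shows "Q v \<and> ops r \<le> a \<and> peak r \<le> h"
  using assms(1)[unfolded triple_def, rule_format, of "\<lparr>ops = 0, live = s, peak = s\<rparr>"] assms(2,3)
  by (simp add: run_from_def)

text \<open>Triples count in natural numbers, whereas the solver bounds are real with a constant of
  unknown sign. \<open>max 0 c\<close> makes the bound nonnegative, and taking the floor loses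
  nothing for a natural number below it.\<close>

lemma le_nat_floor_bound:
  fixes C :: real
  assumes "real k \<le> c * C" "0 \<le> C"
  shows "k \<le> nat \<lfloor>max 0 c * C\<rfloor>"
  using assms mult_right_mono[of c "max 0 c" C] by (intro le_nat_floor) auto

theorem mainTheorem2:
  fixes \<Omega> :: "'a::euclidean_space set" and T :: real and f :: "'a \<times> real \<Rightarrow> real"
    and E :: "nat \<Rightarrow> 'a element set" and m :: "nat \<Rightarrow> nat" and \<psi> :: "nat \<Rightarrow> nat \<Rightarrow> 'a \<Rightarrow> real"
    and schur :: "(complex mat, complex mat \<times> complex mat) routine"
    and solver :: "(complex mat \<times> complex vec, complex vec) routine"
    and C\<^sub>C C\<^sub>S :: "nat \<Rightarrow> real"
    and M\<^sub>x A\<^sub>x :: "nat \<Rightarrow> real mat"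
    and M\<^sub>t A\<^sub>t :: "nat \<Rightarrow> (nat \<Rightarrow> real) \<Rightarrow> real mat"
    and F :: "nat \<Rightarrow> nat \<Rightarrow> (nat \<Rightarrow> real) \<Rightarrow> real vec"
  assumes dim: "DIM('a) \<in> {1, 2, 3}"
    and T: "0 < T"
    and domain: "spatial_domain \<Omega>"
    and f: "square_integrable (\<Omega> \<times> {0<..<T}) f"
    and meshes: "shape_regular_sequence \<Omega> E"
    and basis: "\<And>n. nodal_basis \<Omega> (E n) (m n) (\<psi> n)"
    and M\<^sub>x: "\<And>n. M\<^sub>x n = mass_x \<Omega> (m n) (\<psi> n)"
    and A\<^sub>x: "\<And>n. A\<^sub>x n = stiffness_x \<Omega> (m n) (\<psi> n)"
    and M\<^sub>t: "\<And>N t. M\<^sub>t N t = mass_t T N t"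
    and A\<^sub>t: "\<And>N t. A\<^sub>t N t = stiffness_t T N t"
    and F: "\<And>n N t. F n N t = stack_cols (load_matrix \<Omega> T (E n) (m n) (\<psi> n) N t f)"
    and spatial_spd: "\<And>n. spd (m n) (M\<^sub>x n) \<and> spd (m n) (A\<^sub>x n)"
    and spatial_sparse: "\<exists>c. \<forall>n. real (nnz (M\<^sub>x n)) \<le> c * real (m n) \<and> real (nnz (A\<^sub>x n)) \<le> c * real (m n)"
    and temporal_pd: "\<And>N t. time_mesh T N t \<Longrightarrow> spd N (A\<^sub>t N t) \<and> positive_definite N (M\<^sub>t N t)"
    and schur: "dense_schur_routine schur"
    and solver_correct: "\<And>n N t W S k b.
      \<lbrakk>time_mesh T N t; complex_schur N (cmat (mat_inv (A\<^sub>t N t) * M\<^sub>t N t)) W S; k < N; b \<in> carrier_vec (m n);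
       uniquely_solvable (step3_matrix (M\<^sub>x n) (A\<^sub>x n) S k) b\<rbrakk>
      \<Longrightarrow> solves solver (step3_matrix (M\<^sub>x n) (A\<^sub>x n) S k) b"
    and cost_nonneg: "\<And>i. 0 \<le> C\<^sub>C i" "\<And>i. 0 \<le> C\<^sub>S i"
    and solver_cost: "\<exists>c. \<forall>n N t W S k. \<forall>b\<in>carrier_vec (m n).
      time_mesh T N t \<longrightarrow> complex_schur N (cmat (mat_inv (A\<^sub>t N t) * M\<^sub>t N t)) W S \<longrightarrow> k < N \<longrightarrow>
      real (routine_ops solver (step3_matrix (M\<^sub>x n) (A\<^sub>x n) S k, b)) \<le> c * C\<^sub>C (m n) \<and>
      real (routine_mem solver (step3_matrix (M\<^sub>x n) (A\<^sub>x n) S k, b)) \<le> c * C\<^sub>S (m n)"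
  shows
    "(\<forall>n N t W S k. \<forall>b\<in>carrier_vec (m n).
        time_mesh T N t \<longrightarrow> complex_schur N (cmat (mat_inv (A\<^sub>t N t) * M\<^sub>t N t)) W S \<longrightarrow> k < N \<longrightarrow>
        uniquely_solvable (step3_matrix (M\<^sub>x n) (A\<^sub>x n) S k) b) \<and>
     (\<forall>n N t u. \<forall>F'\<in>carrier_mat (m n) N.
        time_mesh T N t \<longrightarrow> stack_cols F' = F n N t \<longrightarrow>
        bartels_stewart_output N (m n) (A\<^sub>t N t) (M\<^sub>t N t) (M\<^sub>x n) (A\<^sub>x n) F' u \<longrightarrow>
        (\<exists>x. unique_solution (A\<^sub>t N t \<otimes>\<^sub>K M\<^sub>x n + M\<^sub>t N t \<otimes>\<^sub>K A\<^sub>x n) (F n N t) x \<and>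
             u = map_vec complex_of_real x)) \<and>
     (\<exists>C. \<forall>n N t. \<forall>F'\<in>carrier_mat (m n) N.
        time_mesh T N t \<longrightarrow> stack_cols F' = F n N t \<longrightarrow>
        (case run_from (input_size N (m n) (M\<^sub>x n) (A\<^sub>x n))
                (bartels_stewart schur solver (A\<^sub>t N t) (M\<^sub>t N t) (M\<^sub>x n) (A\<^sub>x n) F') of
           (u, r) \<Rightarrow>
             bartels_stewart_output N (m n) (A\<^sub>t N t) (M\<^sub>t N t) (M\<^sub>x n) (A\<^sub>x n) F' u \<and>
             real (ops r) \<le> C * (real N ^ 3 + real (m n) * real N ^ 2 + C\<^sub>C (m n) * real N) \<and>
             real (peak r) \<le> C * (real N ^ 2 + real (m n) * real N + C\<^sub>S (m n))))"
proof (intro conjI)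
  \<comment> \<open>For \<open>N = 0\<close> the mesh conditions would force T = t 0 = 0. Having at
    least one time step is what lets lower-order terms be absorbed.\<close>
  have N_pos: "1 \<le> N" if "time_mesh T N t" for N t
    using that T by (cases N) (auto simp: time_mesh_def)
  have solvable: "uniquely_solvable (step3_matrix (M\<^sub>x n) (A\<^sub>x n) S k) b"
    if "b \<in> carrier_vec (m n)" "time_mesh T N t" "complex_schur N (cmat (mat_inv (A\<^sub>t N t) * M\<^sub>t N t)) W S" "k < N"
    for n N t W S k b
    using step3_uniquely_solvable[OF _ _ schur_diagonal_Re_pos that(1)] spatial_spd temporal_pd that by blast
  then show "\<forall>n N t W S k. \<forall>b\<in>carrier_vec (m n).
        time_mesh T N t \<longrightarrow> complex_schur N (cmat (mat_inv (A\<^sub>t N t) * M\<^sub>t N t)) W S \<longrightarrow> k < N \<longrightarrow>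
        uniquely_solvable (step3_matrix (M\<^sub>x n) (A\<^sub>x n) S k) b"
    by blast
  show "\<forall>n N t u. \<forall>F'\<in>carrier_mat (m n) N.
        time_mesh T N t \<longrightarrow> stack_cols F' = F n N t \<longrightarrow>
        bartels_stewart_output N (m n) (A\<^sub>t N t) (M\<^sub>t N t) (M\<^sub>x n) (A\<^sub>x n) F' u \<longrightarrow>
        (\<exists>x. unique_solution (A\<^sub>t N t \<otimes>\<^sub>K M\<^sub>x n + M\<^sub>t N t \<otimes>\<^sub>K A\<^sub>x n) (F n N t) x \<and>
             u = map_vec complex_of_real x)"
  proof (intro allI ballI impI)
    fix n N t u F'
    assume F': "F' \<in> carrier_mat (m n) N" and mesh: "time_mesh T N t" and "stack_cols F' = F n N t"
      and out: "bartels_stewart_output N (m n) (A\<^sub>t N t) (M\<^sub>t N t) (M\<^sub>x n) (A\<^sub>x n) F' u"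
    then show "\<exists>x. unique_solution (A\<^sub>t N t \<otimes>\<^sub>K M\<^sub>x n + M\<^sub>t N t \<otimes>\<^sub>K A\<^sub>x n) (F n N t) x \<and>
             u = map_vec complex_of_real x"
      using bartels_stewart_output_correct[OF _ _ _ _ F' out] temporal_pd[OF mesh] spatial_spd[of n] by simp
  qed
  obtain c\<^sub>1 where schur_correct: "\<And>N B. B \<in> carrier_mat N N \<Longrightarrow> complex_schur N B (fst (result schur B)) (snd (result schur B))"
    and schur_cost: "\<And>N B. B \<in> carrier_mat N N \<Longrightarrow>
        real (routine_ops schur B) \<le> c\<^sub>1 * real N ^ 3 \<and> real (routine_mem schur B) \<le> c\<^sub>1 * real N ^ 2"
    using schur unfolding dense_schur_routine_def by blast
  obtain c\<^sub>2 where sparse: "\<And>n. real (nnz (M\<^sub>x n)) \<le> c\<^sub>2 * real (m n) \<and> real (nnz (A\<^sub>x n)) \<le> c\<^sub>2 * real (m n)"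
    using spatial_sparse by blast
  obtain c\<^sub>3 where cost: "\<And>n N t W S k b. b \<in> carrier_vec (m n) \<Longrightarrow>
      time_mesh T N t \<Longrightarrow> complex_schur N (cmat (mat_inv (A\<^sub>t N t) * M\<^sub>t N t)) W S \<Longrightarrow> k < N \<Longrightarrow>
      real (routine_ops solver (step3_matrix (M\<^sub>x n) (A\<^sub>x n) S k, b)) \<le> c\<^sub>3 * C\<^sub>C (m n) \<and>
      real (routine_mem solver (step3_matrix (M\<^sub>x n) (A\<^sub>x n) S k, b)) \<le> c\<^sub>3 * C\<^sub>S (m n)"
    using solver_cost by blast
  define \<alpha> where "\<alpha> = max 0 c\<^sub>1"
  define \<beta> where "\<beta> = max 0 c\<^sub>2"
  define \<gamma> where "\<gamma> = max 0 c\<^sub>3"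
  have nonneg: "0 \<le> \<alpha>" "0 \<le> \<beta>" "0 \<le> \<gamma>" by (simp_all add: \<alpha>_def \<beta>_def \<gamma>_def)
  \<comment> \<open>One constant serves both bounds: 31 = 17 + 14 is required by the operations and
    exceeds the 11 + 9 of the storage, while 8 is required by the storage and exceeds the 6 of the
    operations. \<alpha>, \<beta> and \<gamma> belong to the Schur routine, the sparsity and the
    solver; none depends on the meshes.\<close>
  let ?C = "31 + \<alpha> + 8 * \<beta> + \<gamma>"
  have "case run_from (input_size N (m n) (M\<^sub>x n) (A\<^sub>x n))
                (bartels_stewart schur solver (A\<^sub>t N t) (M\<^sub>t N t) (M\<^sub>x n) (A\<^sub>x n) F') of
           (u, r) \<Rightarrow>
             bartels_stewart_output N (m n) (A\<^sub>t N t) (M\<^sub>t N t) (M\<^sub>x n) (A\<^sub>x n) F' u \<and>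
             real (ops r) \<le> ?C * (real N ^ 3 + real (m n) * real N ^ 2 + C\<^sub>C (m n) * real N) \<and>
             real (peak r) \<le> ?C * (real N ^ 2 + real (m n) * real N + C\<^sub>S (m n))"
    if F': "F' \<in> carrier_mat (m n) N" and mesh: "time_mesh T N t" for n N t F'
  proof -
    let ?B = "cmat (mat_inv (A\<^sub>t N t) * M\<^sub>t N t)"
    let ?J = "length (joint_pattern (M\<^sub>x n) (A\<^sub>x n))"
    have At: "spd N (A\<^sub>t N t)" and Mt: "positive_definite N (M\<^sub>t N t)" using temporal_pd[OF mesh] by auto
    have Mx: "spd (m n) (M\<^sub>x n)" and Ax: "spd (m n) (A\<^sub>x n)" using spatial_spd by auto
    have B: "?B \<in> carrier_mat N N"
      using positive_definite_inverse(3)[of N "A\<^sub>t N t"] At Mt by (auto simp: spd_def positive_definite_def)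
    \<comment> \<open>From here on \<open>W\<close> and \<open>S\<close> are the factors that the
      routine actually returns; the solver hypotheses apply to them because they cover every Schur
      decomposition.\<close>
    obtain W S where WS: "result schur ?B = (W, S)" by (cases "result schur ?B")
    have dec: "complex_schur N ?B W S" using schur_correct[OF B] WS by simp
    define oc where "oc = nat \<lfloor>\<gamma> * C\<^sub>C (m n)\<rfloor>"
    define mc where "mc = nat \<lfloor>\<gamma> * C\<^sub>S (m n)\<rfloor>"
    have solver: "solves solver (step3_matrix (M\<^sub>x n) (A\<^sub>x n) S k) b \<and>
        routine_ops solver (step3_matrix (M\<^sub>x n) (A\<^sub>x n) S k, b) \<le> oc \<and>
        routine_mem solver (step3_matrix (M\<^sub>x n) (A\<^sub>x n) S k, b) \<le> mc"
      if "k < N" "b \<in> carrier_vec (m n)" for k b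
      unfolding oc_def mc_def \<gamma>_def
      using solver_correct[OF mesh dec that solvable[OF that(2) mesh dec that(1)]] cost[OF that(2) mesh dec that(1)]
      by (auto intro!: le_nat_floor_bound cost_nonneg)
    define s where "s = input_size N (m n) (M\<^sub>x n) (A\<^sub>x n)"
    define h where "h = s + 4 * (N * N) + 3 * (m n * N) + 2 * N + 2 * m n + csr_size (m n) ?J + routine_mem schur ?B + mc"
    obtain u r where run: "run_from s (bartels_stewart schur solver (A\<^sub>t N t) (M\<^sub>t N t) (M\<^sub>x n) (A\<^sub>x n) F') = (u, r)"
      by (cases "run_from s (bartels_stewart schur solver (A\<^sub>t N t) (M\<^sub>t N t) (M\<^sub>x n) (A\<^sub>x n) F')")
    have "s \<le> h" by (simp add: h_def)
    then have result: "bartels_stewart_output N (m n) (A\<^sub>t N t) (M\<^sub>t N t) (M\<^sub>x n) (A\<^sub>x n) F' u"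
      and ops: "ops r \<le> N * (2 * N + 2 + N * (2 * N + 2)) + (N * (2 * (N * (2 * N + 2))) + (routine_ops schur ?B +
        (m n * (2 * (N * (2 * N + 2))) + (N * N + (m n * (N * (2 * N)) +
        (N * (N * (2 * nnz (A\<^sub>x n) + 2 * m n) + 2 * ?J + oc) + (m n * (N * (2 * N)) + 0)))))))"
      and peak: "peak r \<le> h"
      using run_from_triple[OF triple_bartels_stewart[OF At Mt Mx Ax F' dec WS order_refl order_refl solver,
            of s h] run] by (simp_all add: h_def)
    have J: "?J \<le> nnz (M\<^sub>x n) + nnz (A\<^sub>x n)"
      using Mx Ax by (intro length_joint_pattern[of _ "m n"]) (auto simp: spd_def positive_definite_def)
    have nz: "real (nnz (M\<^sub>x n)) \<le> \<beta> * real (m n)" "real (nnz (A\<^sub>x n)) \<le> \<beta> * real (m n)"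
      using sparse[of n] mult_right_mono[of c\<^sub>2 \<beta> "real (m n)"] by (auto simp: \<beta>_def)
    then have J: "real ?J \<le> 2 * (\<beta> * real (m n))" using J by linarith
    have sc: "real (routine_ops schur ?B) \<le> \<alpha> * real N ^ 3" "real (routine_mem schur ?B) \<le> \<alpha> * real N ^ 2"
      using schur_cost[OF B] mult_right_mono[of c\<^sub>1 \<alpha> "real N ^ 3"] mult_right_mono[of c\<^sub>1 \<alpha> "real N ^ 2"]
      by (auto simp: \<alpha>_def)
    have oc: "real oc \<le> \<gamma> * C\<^sub>C (m n)" and mc: "real mc \<le> \<gamma> * C\<^sub>S (m n)"
      using nonneg(3) cost_nonneg by (simp_all add: oc_def mc_def)
    have N: "1 \<le> real N" using N_pos[OF mesh] by simp
    have "real (ops r) \<le> ?C * (real N ^ 3 + real (m n) * real N ^ 2 + C\<^sub>C (m n) * real N)"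
      using order_trans[OF of_nat_mono[OF ops, where 'a = real, unfolded of_nat_add of_nat_mult of_nat_numeral of_nat_0]
          operation_count_bound[OF N of_nat_0_le_iff nonneg cost_nonneg(1) sc(1) nz(2) J oc]] .
    moreover have "real (peak r) \<le> ?C * (real N ^ 2 + real (m n) * real N + C\<^sub>S (m n))"
      using order_trans[OF of_nat_mono[OF peak, where 'a = real,
            unfolded h_def s_def input_size_def csr_size_def of_nat_add of_nat_mult of_nat_numeral of_nat_1]
          storage_bound[OF N of_nat_0_le_iff nonneg cost_nonneg(2) sc(2) nz J mc]] .
    ultimately show ?thesis
      using result run by (simp add: s_def)
  qed
  then show "\<exists>C. \<forall>n N t. \<forall>F'\<in>carrier_mat (m n) N.
        time_mesh T N t \<longrightarrow> stack_cols F' = F n N t \<longrightarrow>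
        (case run_from (input_size N (m n) (M\<^sub>x n) (A\<^sub>x n))
                (bartels_stewart schur solver (A\<^sub>t N t) (M\<^sub>t N t) (M\<^sub>x n) (A\<^sub>x n) F') of
           (u, r) \<Rightarrow>
             bartels_stewart_output N (m n) (A\<^sub>t N t) (M\<^sub>t N t) (M\<^sub>x n) (A\<^sub>x n) F' u \<and>
             real (ops r) \<le> C * (real N ^ 3 + real (m n) * real N ^ 2 + C\<^sub>C (m n) * real N) \<and>
             real (peak r) \<le> C * (real N ^ 2 + real (m n) * real N + C\<^sub>S (m n)))"
    by (intro exI[of _ ?C] allI ballI impI)
qed

end
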